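(* The space $\operatorname{Imm}^{0}(S^1,\mathbb R^2)$ of degree $0$ immersions of the circle in the plane is homotopy equivalent to $S^1$.
   Context: For a smooth immersion $c:S^1\to\mathbb R^2$ the (rotation) degree is the winding number of $c':S^1\to\mathbb R^2\setminus\{0\}$ around $0$, where $c$ is viewed as a $2\pi$-periodic function of $\theta$. $\operatorname{Imm}^0(S^1,\mathbb R^2)$ is the space of all smooth immersions $S^1\to\mathbb R^2$ of degree $0$, with the $C^\infty$-topology. *)

theory Defs
  imports "HOL-Complex_Analysis.Complex_Analysis"
begin

text \<open>
  The plane is the type \<^typ>\<open>complex\<close>, so that the library's \<^const>\<open>winding_number\<close> applies.
  A map on the circle is represented by the corresponding \<open>2\<pi>\<close>-periodic function of the
  angle \<open>\<theta>\<close>; all derivatives are taken with respect to \<open>\<theta>\<close>.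
\<close>

definition theta_deriv :: "(real \<Rightarrow> complex) \<Rightarrow> real \<Rightarrow> complex" where
  "theta_deriv c = (\<lambda>\<theta>. vector_derivative c (at \<theta>))"

definition smooth_loops :: "(real \<Rightarrow> complex) set" where
  "smooth_loops = {c. (\<forall>\<theta>. c (\<theta> + 2 * pi) = c \<theta>) \<and>
                      (\<forall>k \<theta>. (theta_deriv ^^ k) c differentiable (at \<theta>))}"

text \<open>
  The \<open>C\<^sup>\<infinity>\<close>-topology: uniform convergence of each derivative. The basic
  neighbourhoods of \<open>c\<close> are given by uniform closeness of the derivatives up to some finite
  order \<open>n\<close>.
\<close>

definition Cinf_open :: "(real \<Rightarrow> complex) set \<Rightarrow> bool" where
  "Cinf_open U \<longleftrightarrow> U \<subseteq> smooth_loops \<and>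
     (\<forall>c\<in>U. \<exists>n. \<exists>\<epsilon>>0. \<forall>d\<in>smooth_loops.
        (\<forall>k\<le>n. \<forall>\<theta>. dist ((theta_deriv ^^ k) d \<theta>) ((theta_deriv ^^ k) c \<theta>) < \<epsilon>) \<longrightarrow> d \<in> U)"

definition Cinf_topology :: "(real \<Rightarrow> complex) topology" where
  "Cinf_topology = topology Cinf_open"

lemma istopology_Cinf_open: "istopology Cinf_open"
  unfolding istopology_def
proof (intro conjI allI impI)
  fix S T
  assume S: "Cinf_open S" and T: "Cinf_open T"
  show "Cinf_open (S \<inter> T)"
    unfolding Cinf_open_def
  proof (intro conjI ballI)
    show "S \<inter> T \<subseteq> smooth_loops"
      using S by (auto simp: Cinf_open_def)
  next
    fix c
    assume c: "c \<in> S \<inter> T"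
    let ?close = "\<lambda>n \<epsilon> d. \<forall>k\<le>(n::nat). \<forall>\<theta>.
      dist ((theta_deriv ^^ k) d \<theta>) ((theta_deriv ^^ k) c \<theta>) < (\<epsilon>::real)"
    obtain m \<epsilon> where m: "\<epsilon> > 0" "\<And>d. d \<in> smooth_loops \<Longrightarrow> ?close m \<epsilon> d \<Longrightarrow> d \<in> S"
      using S c unfolding Cinf_open_def by blast
    obtain n \<delta> where n: "\<delta> > 0" "\<And>d. d \<in> smooth_loops \<Longrightarrow> ?close n \<delta> d \<Longrightarrow> d \<in> T"
      using T c unfolding Cinf_open_def by blast
    have "d \<in> S \<inter> T" if "d \<in> smooth_loops" "?close (max m n) (min \<epsilon> \<delta>) d" for d
      using that by (intro IntI m(2) n(2)) auto
    then show "\<exists>n. \<exists>\<epsilon>>0. \<forall>d\<in>smooth_loops. ?close n \<epsilon> d \<longrightarrow> d \<in> S \<inter> T"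
      using m(1) n(1) by (intro exI[of _ "max m n"] exI[of _ "min \<epsilon> \<delta>"]) auto
  qed
next
  fix \<K>
  assume K: "\<forall>K\<in>\<K>. Cinf_open K"
  show "Cinf_open (\<Union>\<K>)"
    unfolding Cinf_open_def
  proof (intro conjI ballI)
    show "\<Union>\<K> \<subseteq> smooth_loops"
      using K by (auto simp: Cinf_open_def)
  next
    fix c
    assume "c \<in> \<Union>\<K>"
    then obtain K where "K \<in> \<K>" "c \<in> K" by blast
    moreover from this K have "Cinf_open K" by blast
    ultimately show "\<exists>n. \<exists>\<epsilon>>0. \<forall>d\<in>smooth_loops.
        (\<forall>k\<le>n. \<forall>\<theta>. dist ((theta_deriv ^^ k) d \<theta>) ((theta_deriv ^^ k) c \<theta>) < \<epsilon>)
          \<longrightarrow> d \<in> \<Union>\<K>"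
      unfolding Cinf_open_def by (meson UnionI)
  qed
qed

lemma openin_Cinf_topology: "openin Cinf_topology U \<longleftrightarrow> Cinf_open U"
  by (simp add: Cinf_topology_def istopology_Cinf_open topology_inverse')

lemma topspace_Cinf_topology: "topspace Cinf_topology = smooth_loops"
proof
  show "topspace Cinf_topology \<subseteq> smooth_loops"
    by (auto simp: topspace_def openin_Cinf_topology Cinf_open_def)
  have "Cinf_open smooth_loops"
    unfolding Cinf_open_def by (auto intro: exI[of _ "1::real"])
  then show "smooth_loops \<subseteq> topspace Cinf_topology"
    by (simp add: openin_Cinf_topology openin_subset)
qed

text \<open>The circle is one-dimensional, so the differential is injective iff it is nonzero.\<close>

definition immersions :: "(real \<Rightarrow> complex) set" where
  "immersions = {c \<in> smooth_loops. \<forall>\<theta>. theta_deriv c \<theta> \<noteq> 0}"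

text \<open>Library paths are parametrized by \<open>[0,1]\<close>, hence the rescaling of \<open>\<theta>\<close>.\<close>

definition rotation_degree :: "(real \<Rightarrow> complex) \<Rightarrow> complex" where
  "rotation_degree c = winding_number (\<lambda>t. theta_deriv c (2 * pi * t)) 0"

definition Imm :: "int \<Rightarrow> (real \<Rightarrow> complex) topology" where
  "Imm m = subtopology Cinf_topology {c \<in> immersions. rotation_degree c = of_int m}"

end

theory Submission
  imports Defs
begin

text \<open>
Write the velocity of an immersion of degree \<open>0\<close> as \<open>c' = c'(0) exp l\<close>. The degree vanishes
exactly when the logarithm \<open>l\<close> is again a loop, and \<open>c\<close> being closed means that \<open>exp l\<close> has
integral zero. So \<open>c\<close> amounts to its starting point, its initial velocity and a loop \<open>l\<close>
with \<open>\<integral> exp l = 0\<close>, where \<open>Re l\<close> governs the speed and \<open>Im l\<close> is the angle of the tangent.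

If \<open>\<integral> exp l = 0\<close>, then the angle oscillates by more than \<open>\<pi>\<close>, since otherwise all tangents would
lie in a half plane (\<open>exp_integral_zero_wide\<close>); such loops \<open>l\<close> are called wide. Conversely a wide
loop can be closed up canonically by changing the speed alone. Consider
\<open>E(w) = \<integral> exp (Re l + \<langle>w, cis (Im l)\<rangle>)\<close> for \<open>w\<close> in the plane. This function is strictly convex, and it is
proper because the tangents lie in no half plane, so it has a unique critical point \<open>v\<close>. That the
gradient vanishes at \<open>v\<close> says \<open>\<integral> exp (l + \<langle>v, cis (Im l)\<rangle>) = 0\<close>. Thus every wide loop yields a closed curve
with the same tangent angle, \<open>v\<close> depends continuously on \<open>l\<close> (\<open>continuous_map_closing_vector\<close>), and
\<open>v = 0\<close> if \<open>\<integral> exp l\<close> was zero from the start. As \<open>v\<close> is a finite-dimensional parameter, the resulting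
curve depends on \<open>l\<close> continuously in the \<open>C\<^sup>\<infinity>\<close>-topology (\<open>continuous_map_closed_curve\<close>), and it remains
to deform wide loops without caring about the integral.

The wide loops can be contracted explicitly (\<open>wide_deform\<close>). Precompose \<open>l\<close> with
\<open>\<theta> + a sin \<theta>\<close>, where \<open>a\<close> grows from \<open>0\<close> to \<open>3\<pi>/2\<close>. This map of the circle has degree one, hence is
onto, and the oscillation of the angle does not change. For \<open>a = 3\<pi>/2\<close> the upper and the lower half
circle each cover the whole circle. Therefore adding \<open>i s sin \<theta>\<close> with \<open>s \<ge> 0\<close> can only increase the
oscillation: the sine raises the angle at a point over the maximum and lowers it at a point
over the minimum. Once \<open>s = 2\<close>, the two points \<open>\<pi>/2\<close> and \<open>3\<pi>/2\<close>, which lie over the same point of the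
circle, have angles that differ by \<open>4 > \<pi>\<close>, and \<open>l\<close> can be faded out. At the end only the initial
direction \<open>c'(0) / |c'(0)|\<close> still depends on \<open>c\<close>, and the curve is a rotated figure eight.
\<close>

section \<open>Periodic functions depending continuously on a parameter\<close>

text \<open>
A parametrized family of loops is required to be continuous jointly in the parameter and the
angle. By compactness of the circle this means that the members are continuous and depend
continuously on the parameter for the supremum distance (\<open>loop_family_uniform\<close> and
\<open>loop_familyI_uniform\<close>), but joint continuity is evidently preserved by pointwise operations and
by reparametrization of the angle.
\<close>

definition loop_family :: "'x topology \<Rightarrow> ('x \<Rightarrow> real \<Rightarrow> complex) \<Rightarrow> bool" where
  "loop_family X F \<longleftrightarrow>
     (\<forall>x\<in>topspace X. \<forall>\<theta>. F x (\<theta> + 2 * pi) = F x \<theta>) \<and>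
     continuous_map (prod_topology X euclideanreal) euclidean (\<lambda>p. F (fst p) (snd p))"

lemma continuous_map_euclidean_atin:
  "continuous_map Z euclidean f \<longleftrightarrow> (\<forall>z\<in>topspace Z. (f \<longlongrightarrow> f z) (atin Z z))"
  by (simp add: continuous_map_atin)

lemma continuous_map_slice:
  fixes f :: "'a \<times> real \<Rightarrow> 'b::topological_space"
  assumes "continuous_map (prod_topology X euclideanreal) euclidean f" "x \<in> topspace X"
  shows "continuous_on UNIV (\<lambda>\<theta>. f (x, \<theta>))"
proof -
  have "continuous_map euclideanreal (prod_topology X euclideanreal) (\<lambda>\<theta>. (x, \<theta>))"
    using assms(2) by (simp add: continuous_map_paired)
  then have "continuous_map euclideanreal euclidean (f \<circ> (\<lambda>\<theta>. (x, \<theta>)))"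
    using assms(1) continuous_map_compose by blast
  then show ?thesis by (simp add: o_def)
qed

lemma loop_family_continuous:
  assumes "loop_family X F" "x \<in> topspace X"
  shows "continuous_on UNIV (F x)"
  using continuous_map_slice[of X "\<lambda>p. F (fst p) (snd p)" x] assms by (simp add: loop_family_def)

lemma periodic_reduce:
  fixes \<theta> :: real
  obtains \<theta>' where "\<theta>' \<in> {0..2 * pi}"
    "\<And>f::real \<Rightarrow> 'a. (\<And>s. f (s + 2 * pi) = f s) \<Longrightarrow> f \<theta> = f \<theta>'"
proof
  define n where "n = \<lfloor>\<theta> / (2 * pi)\<rfloor>"
  have "of_int n \<le> \<theta> / (2 * pi)" "\<theta> / (2 * pi) < of_int n + 1"
    unfolding n_def by linarith+
  then have "of_int n * (2 * pi) \<le> \<theta>" "\<theta> < (of_int n + 1) * (2 * pi)"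
    by (simp_all add: field_simps)
  then show "\<theta> - of_int n * (2 * pi) \<in> {0..2 * pi}"
    by (simp add: algebra_simps)
  fix f :: "real \<Rightarrow> 'a"
  assume f: "\<And>s. f (s + 2 * pi) = f s"
  interpret periodic_fun_simple f "2 * pi" by standard (rule f)
  show "f \<theta> = f (\<theta> - of_int n * (2 * pi))"
    by (simp add: minus_of_int)
qed

text \<open>
The tube lemma, applied to a fundamental domain \<open>[0,2\<pi>]\<close>.
\<close>

lemma loop_family_uniform:
  assumes F: "loop_family X F" and x: "x \<in> topspace X" and "\<epsilon> > 0"
  obtains U where "openin X U" "x \<in> U" "\<And>y \<theta>. y \<in> U \<Longrightarrow> dist (F y \<theta>) (F x \<theta>) < \<epsilon>"
proof -
  let ?Z = "prod_topology X euclideanreal"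
  have c1: "continuous_map ?Z euclidean (\<lambda>p. F (fst p) (snd p))"
    using F by (simp add: loop_family_def)
  have "continuous_map ?Z ?Z (\<lambda>p. (x, snd p))"
    using x by (intro continuous_map_pairedI) (auto intro: continuous_map_snd)
  from continuous_map_compose[OF this c1]
  have c2: "continuous_map ?Z euclidean (\<lambda>p. F x (snd p))" by (simp add: o_def)
  have c3: "continuous_map ?Z euclidean (\<lambda>p. dist (F (fst p) (snd p)) (F x (snd p)))"
    using c1 c2 by (auto simp: continuous_map_euclidean_atin intro!: tendsto_dist)
  let ?W = "{p \<in> topspace ?Z. dist (F (fst p) (snd p)) (F x (snd p)) \<in> {..<\<epsilon>}}"
  have W: "openin ?Z ?W"
    by (rule openin_continuous_map_preimage[OF c3]) auto
  have K: "compactin X {x}" "compactin euclideanreal {0..2 * pi}"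
    using x by (auto simp: compactin_sing)
  have sub: "{x} \<times> {0..2 * pi} \<subseteq> ?W"
    using x \<open>\<epsilon> > 0\<close> by auto
  obtain U V where UV: "openin X U" "{x} \<subseteq> U" "{0..2 * pi} \<subseteq> V" "U \<times> V \<subseteq> ?W"
    by (rule Wallace_theorem_prod_topology[OF K W sub])
  show thesis
  proof
    show "openin X U" "x \<in> U" using UV by auto
    fix y \<theta> assume y: "y \<in> U"
    then have yX: "y \<in> topspace X" using UV(1) openin_subset by blast
    obtain \<theta>' where t: "\<theta>' \<in> {0..2 * pi}"
      "\<And>f::real \<Rightarrow> real. (\<And>s. f (s + 2 * pi) = f s) \<Longrightarrow> f \<theta> = f \<theta>'"
      using periodic_reduce by blast
    have "dist (F y \<theta>) (F x \<theta>) = dist (F y \<theta>') (F x \<theta>')"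
      using F x yX by (intro t(2)[of "\<lambda>\<theta>. dist (F y \<theta>) (F x \<theta>)"]) (simp add: loop_family_def)
    moreover have "(y, \<theta>') \<in> ?W" using y t(1) UV by blast
    ultimately show "dist (F y \<theta>) (F x \<theta>) < \<epsilon>" by simp
  qed
qed

lemma loop_familyI_uniform:
  assumes per: "\<And>x \<theta>. x \<in> topspace X \<Longrightarrow> F x (\<theta> + 2 * pi) = F x \<theta>"
    and cont: "\<And>x. x \<in> topspace X \<Longrightarrow> continuous_on UNIV (F x)"
    and unif: "\<And>x \<epsilon>. x \<in> topspace X \<Longrightarrow> \<epsilon> > 0 \<Longrightarrow>
      \<exists>U. openin X U \<and> x \<in> U \<and> (\<forall>y\<in>U. \<forall>\<theta>. dist (F y \<theta>) (F x \<theta>) < \<epsilon>)"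
  shows "loop_family X F"
  unfolding loop_family_def
proof (intro conjI ballI allI)
  let ?Z = "prod_topology X euclideanreal"
  show "continuous_map ?Z euclidean (\<lambda>p. F (fst p) (snd p))"
    unfolding continuous_map_euclidean_atin tendsto_iff
  proof (intro ballI allI impI)
    fix p :: "'a \<times> real" and \<epsilon> :: real
    assume p: "p \<in> topspace ?Z" and e: "\<epsilon> > 0"
    obtain x t where pe: "p = (x, t)" "x \<in> topspace X" using p by auto
    obtain U where U: "openin X U" "x \<in> U" "\<And>y \<theta>. y \<in> U \<Longrightarrow> dist (F y \<theta>) (F x \<theta>) < \<epsilon>/2"
      using unif[OF pe(2), of "\<epsilon>/2"] e by auto
    obtain \<delta> where d: "\<delta> > 0" "\<And>s. dist s t < \<delta> \<Longrightarrow> dist (F x s) (F x t) < \<epsilon>/2"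
      using cont[OF pe(2)] e unfolding continuous_on_iff
      by (metis UNIV_I half_gt_zero)
    have "openin ?Z (U \<times> ball t \<delta>)"
      using U(1) by (simp add: openin_prod_Times_iff)
    moreover have "p \<in> U \<times> ball t \<delta>" using U(2) d(1) pe by simp
    moreover have "dist (F (fst q) (snd q)) (F (fst p) (snd p)) < \<epsilon>" if q: "q \<in> U \<times> ball t \<delta>" for q
    proof -
      have "dist (F (fst q) (snd q)) (F x (snd q)) < \<epsilon>/2"
        using q U(3) by auto
      moreover have "dist (F x (snd q)) (F x t) < \<epsilon>/2"
        using q by (intro d(2)) (auto simp: dist_commute)
      ultimately show ?thesis
        using dist_triangle[of "F (fst q) (snd q)" "F x t" "F x (snd q)"] pe by simp
    qed
    ultimately show "\<forall>\<^sub>F q in atin ?Z p. dist (F (fst q) (snd q)) (F (fst p) (snd p)) < \<epsilon>"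
      unfolding eventually_atin by blast
  qed
qed (use per in auto)

lemma loop_family_eval:
  assumes "loop_family X F"
  shows "continuous_map X euclidean (\<lambda>x. F x \<theta>)"
proof -
  have "continuous_map X (prod_topology X euclideanreal) (\<lambda>x. (x, \<theta>))"
    by (intro continuous_map_pairedI) auto
  from continuous_map_compose[OF this, of euclidean "\<lambda>p. F (fst p) (snd p)"] assms
  show ?thesis by (simp add: loop_family_def o_def)
qed

lemma loop_family_pullback:
  assumes "loop_family Y F" and h: "continuous_map X Y h"
  shows "loop_family X (\<lambda>x. F (h x))"
proof -
  have "continuous_map (prod_topology X euclideanreal) (prod_topology Y euclideanreal) (\<lambda>p. (h (fst p), snd p))"
    by (intro continuous_map_pairedI continuous_map_snd continuous_map_compose[OF continuous_map_fst h, unfolded o_def])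
  from continuous_map_compose[OF this, of euclidean "\<lambda>p. F (fst p) (snd p)"] assms
  show ?thesis by (auto simp: loop_family_def o_def continuous_map_def)
qed

section \<open>Families of loops of finite differentiability\<close>

text \<open>
Families that are \<open>k\<close> times differentiable in the angle, all derivatives being jointly
continuous. The recursion peels off the first derivative, so that closure under an operation
follows by induction on \<open>k\<close> from the corresponding differentiation rule.
\<close>

primrec Ck_family :: "nat \<Rightarrow> 'x topology \<Rightarrow> ('x \<Rightarrow> real \<Rightarrow> complex) \<Rightarrow> bool" where
  "Ck_family 0 X F \<longleftrightarrow> loop_family X F"
| "Ck_family (Suc k) X F \<longleftrightarrow> loop_family X F \<and>
     (\<exists>G. (\<forall>x\<in>topspace X. \<forall>\<theta>. (F x has_vector_derivative G x \<theta>) (at \<theta>)) \<and> Ck_family k X G)"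

lemma Ck_family_SucI:
  assumes "loop_family X F" "Ck_family k X G"
    "\<And>x \<theta>. x \<in> topspace X \<Longrightarrow> (F x has_vector_derivative G x \<theta>) (at \<theta>)"
  shows "Ck_family (Suc k) X F"
  using assms by auto

lemma Ck_family_SucE:
  assumes "Ck_family (Suc k) X F"
  obtains F' where "loop_family X F" "Ck_family k X F'"
    "\<forall>x\<in>topspace X. \<forall>\<theta>. (F x has_vector_derivative F' x \<theta>) (at \<theta>)"
  using assms by auto

lemma Ck_family_loop_family: "Ck_family k X F \<Longrightarrow> loop_family X F"
  by (cases k) auto

lemma Ck_family_SucD: "Ck_family (Suc k) X F \<Longrightarrow> Ck_family k X F"
proof (induction k arbitrary: F)
  case (Suc k)
  obtain G where "loop_family X F" "Ck_family (Suc k) X G"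
    "\<forall>x\<in>topspace X. \<forall>\<theta>. (F x has_vector_derivative G x \<theta>) (at \<theta>)"
    using Suc.prems by (rule Ck_family_SucE)
  with Suc.IH show ?case by auto
qed simp

lemma loop_family_cong:
  assumes "loop_family X F" "\<And>x \<theta>. x \<in> topspace X \<Longrightarrow> F x \<theta> = G x \<theta>"
  shows "loop_family X G"
proof -
  have "continuous_map (prod_topology X euclideanreal) euclidean (\<lambda>p. G (fst p) (snd p))"
    by (rule continuous_map_eq[of _ _ "\<lambda>p. F (fst p) (snd p)"]) (use assms in \<open>auto simp: loop_family_def\<close>)
  with assms show ?thesis by (simp add: loop_family_def)
qed

lemma Ck_family_cong:
  assumes "Ck_family k X F" "\<And>x \<theta>. x \<in> topspace X \<Longrightarrow> F x \<theta> = G x \<theta>"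
  shows "Ck_family k X G"
proof (cases k)
  case 0
  with assms show ?thesis using loop_family_cong by fastforce
next
  case (Suc j)
  with assms(1) obtain H where H: "loop_family X F" "Ck_family j X H"
    "\<And>x \<theta>. x \<in> topspace X \<Longrightarrow> (F x has_vector_derivative H x \<theta>) (at \<theta>)"
    by auto
  have "F x = G x" if "x \<in> topspace X" for x using assms(2)[OF that] by auto
  with H show ?thesis unfolding Suc
    by (intro Ck_family_SucI[of X G j H] loop_family_cong[OF H(1)]) auto
qed

lemma loop_family_iff:
  "loop_family X F \<longleftrightarrow> (\<forall>x\<in>topspace X. \<forall>\<theta>. F x (\<theta> + 2 * pi) = F x \<theta>) \<and>
     (\<forall>x\<in>topspace X. \<forall>\<theta>. ((\<lambda>p. F (fst p) (snd p)) \<longlongrightarrow> F x \<theta>) (atin (prod_topology X euclideanreal) (x, \<theta>)))"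
  by (auto simp: loop_family_def continuous_map_euclidean_atin)

lemma Ck_family_constant:
  assumes "continuous_map X euclidean h"
  shows "Ck_family k X (\<lambda>x \<theta>. h x)"
proof -
  have l: "loop_family X (\<lambda>x \<theta>. h x)" if "continuous_map X euclidean h" for h :: "'a \<Rightarrow> complex"
    using continuous_map_compose[OF continuous_map_fst that]
    by (auto simp: loop_family_def o_def)
  show ?thesis using assms
  proof (induction k arbitrary: h)
    case (Suc k)
    show ?case
      by (rule Ck_family_SucI[OF l Suc.IH[of "\<lambda>_. 0"]]) (use Suc.prems in auto)
  qed (simp add: l)
qed

lemma loop_family_add: "loop_family X F \<Longrightarrow> loop_family X G \<Longrightarrow> loop_family X (\<lambda>x \<theta>. F x \<theta> + G x \<theta>)"
  unfolding loop_family_iff by (auto intro!: tendsto_add)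

lemma loop_family_mult: "loop_family X F \<Longrightarrow> loop_family X G \<Longrightarrow> loop_family X (\<lambda>x \<theta>. F x \<theta> * G x \<theta>)"
  unfolding loop_family_iff by (auto intro!: tendsto_mult)

lemma loop_family_bounded_linear:
  assumes T: "bounded_linear T"
  shows "loop_family X F \<Longrightarrow> loop_family X (\<lambda>x \<theta>. T (F x \<theta>))"
  unfolding loop_family_iff by (simp add: bounded_linear.tendsto[OF T])

lemma loop_family_exp: "loop_family X F \<Longrightarrow> loop_family X (\<lambda>x \<theta>. exp (F x \<theta>))"
  unfolding loop_family_iff by (auto intro!: tendsto_exp)

lemma loop_family_inverse:
  "loop_family X F \<Longrightarrow> (\<And>x \<theta>. x \<in> topspace X \<Longrightarrow> F x \<theta> \<noteq> 0) \<Longrightarrow> loop_family X (\<lambda>x \<theta>. inverse (F x \<theta>))"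
  unfolding loop_family_iff by (auto intro!: tendsto_inverse)

lemma Ck_family_add:
  "Ck_family k X F \<Longrightarrow> Ck_family k X G \<Longrightarrow> Ck_family k X (\<lambda>x \<theta>. F x \<theta> + G x \<theta>)"
proof (induction k arbitrary: F G dF dG)
  case (Suc k)
  obtain F' where F: "loop_family X F" "Ck_family k X F'"
    and dF: "\<forall>x\<in>topspace X. \<forall>\<theta>. (F x has_vector_derivative F' x \<theta>) (at \<theta>)"
    using Suc.prems(1) by (rule Ck_family_SucE)
  note dF = dF[rule_format]
  obtain G' where G: "loop_family X G" "Ck_family k X G'"
    and dG: "\<forall>x\<in>topspace X. \<forall>\<theta>. (G x has_vector_derivative G' x \<theta>) (at \<theta>)"
    using Suc.prems(2) by (rule Ck_family_SucE)
  note dG = dG[rule_format]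
  show ?case
    by (intro Ck_family_SucI[OF loop_family_add Suc.IH[of F' G']]
        has_vector_derivative_add F G dF dG)
qed (simp add: loop_family_add)

lemma Ck_family_mult:
  "Ck_family k X F \<Longrightarrow> Ck_family k X G \<Longrightarrow> Ck_family k X (\<lambda>x \<theta>. F x \<theta> * G x \<theta>)"
proof (induction k arbitrary: F G dF dG)
  case (Suc k)
  obtain F' where F: "loop_family X F" "Ck_family k X F'"
    and dF: "\<forall>x\<in>topspace X. \<forall>\<theta>. (F x has_vector_derivative F' x \<theta>) (at \<theta>)"
    using Suc.prems(1) by (rule Ck_family_SucE)
  note dF = dF[rule_format]
  obtain G' where G: "loop_family X G" "Ck_family k X G'"
    and dG: "\<forall>x\<in>topspace X. \<forall>\<theta>. (G x has_vector_derivative G' x \<theta>) (at \<theta>)"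
    using Suc.prems(2) by (rule Ck_family_SucE)
  note dG = dG[rule_format]
  show ?case
    by (rule Ck_family_SucI[OF loop_family_mult[OF F(1) G(1)]
          Ck_family_add[OF Suc.IH[OF Ck_family_SucD[OF Suc.prems(1)] G(2)]
            Suc.IH[OF F(2) Ck_family_SucD[OF Suc.prems(2)]]]])
      (rule has_vector_derivative_mult[OF dF dG])
qed (simp add: loop_family_mult)

lemma Ck_family_bounded_linear:
  assumes "bounded_linear T"
  shows "Ck_family k X F \<Longrightarrow> Ck_family k X (\<lambda>x \<theta>. T (F x \<theta>))"
proof (induction k arbitrary: F)
  case (Suc k)
  obtain F' where F: "loop_family X F" "Ck_family k X F'"
    and dF: "\<forall>x\<in>topspace X. \<forall>\<theta>. (F x has_vector_derivative F' x \<theta>) (at \<theta>)"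
    using Suc.prems by (rule Ck_family_SucE)
  note dF = dF[rule_format]
  show ?case
    by (intro Ck_family_SucI[OF loop_family_bounded_linear[OF assms] Suc.IH[of F']]
        bounded_linear.has_vector_derivative[OF assms] F dF)
qed (simp add: loop_family_bounded_linear assms)

lemma Ck_family_exp: "Ck_family k X F \<Longrightarrow> Ck_family k X (\<lambda>x \<theta>. exp (F x \<theta>))"
proof (induction k arbitrary: F)
  case (Suc k)
  obtain F' where F: "loop_family X F" "Ck_family k X F'"
    and dF: "\<forall>x\<in>topspace X. \<forall>\<theta>. (F x has_vector_derivative F' x \<theta>) (at \<theta>)"
    using Suc.prems(1) by (rule Ck_family_SucE)
  note dF = dF[rule_format]
  have "((\<lambda>\<theta>. exp (F x \<theta>)) has_vector_derivative F' x \<theta> * exp (F x \<theta>)) (at \<theta>)"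
    if "x \<in> topspace X" for x \<theta>
    using field_vector_diff_chain_at[OF dF[OF that] DERIV_exp] by (simp add: o_def)
  then show ?case
    by (rule Ck_family_SucI[OF loop_family_exp[OF F(1)]
          Ck_family_mult[OF F(2) Suc.IH[OF Ck_family_SucD[OF Suc.prems]]]])
qed (simp add: loop_family_exp)

lemma Ck_family_inverse:
  "Ck_family k X F \<Longrightarrow> (\<And>x \<theta>. x \<in> topspace X \<Longrightarrow> F x \<theta> \<noteq> 0) \<Longrightarrow> Ck_family k X (\<lambda>x \<theta>. inverse (F x \<theta>))"
proof (induction k arbitrary: F)
  case (Suc k)
  obtain F' where F: "loop_family X F" "Ck_family k X F'"
    and dF: "\<forall>x\<in>topspace X. \<forall>\<theta>. (F x has_vector_derivative F' x \<theta>) (at \<theta>)"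
    using Suc.prems(1) by (rule Ck_family_SucE)
  note dF = dF[rule_format]
  have I: "Ck_family k X (\<lambda>x \<theta>. inverse (F x \<theta>))"
    using Suc.IH[OF Ck_family_SucD[OF Suc.prems(1)]] Suc.prems(2) by blast
  have "Ck_family k X (\<lambda>x \<theta>. F' x \<theta> * (- (inverse (F x \<theta>) * inverse (F x \<theta>))))"
    using Ck_family_mult[OF F(2) Ck_family_bounded_linear[OF bounded_linear_minus[OF bounded_linear_ident] Ck_family_mult[OF I I]]] .
  moreover have "((\<lambda>\<theta>. inverse (F x \<theta>)) has_vector_derivative
      F' x \<theta> * (- (inverse (F x \<theta>) * inverse (F x \<theta>)))) (at \<theta>)"
    if "x \<in> topspace X" for x \<theta>
    using field_vector_diff_chain_at[OF dF[OF that] DERIV_inverse[OF Suc.prems(2)[OF that]]]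
    by (simp add: o_def power2_eq_square)
  moreover have "loop_family X (\<lambda>x \<theta>. inverse (F x \<theta>))"
    by (rule loop_family_inverse[OF F(1)]) (rule Suc.prems(2))
  ultimately show ?case
    by (rule Ck_family_SucI[rotated])
qed (simp add: loop_family_inverse)

lemma loop_family_compose:
  assumes F: "loop_family X F" and P: "loop_family X P"
  shows "loop_family X (\<lambda>x \<theta>. F x (\<theta> + Re (P x \<theta>)))"
  unfolding loop_family_def
proof (intro conjI ballI allI)
  let ?Z = "prod_topology X euclideanreal"
  have "continuous_map ?Z euclideanreal (\<lambda>p. snd p + Re (P (fst p) (snd p)))"
  proof (rule continuous_map_add)
    show "continuous_map ?Z euclideanreal snd" by (rule continuous_map_snd)
    show "continuous_map ?Z euclideanreal (\<lambda>p. Re (P (fst p) (snd p)))"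
      using P by (auto simp: loop_family_def continuous_map_euclidean_atin intro!: tendsto_Re)
  qed
  then have "continuous_map ?Z ?Z (\<lambda>p. (fst p, snd p + Re (P (fst p) (snd p))))"
    by (intro continuous_map_pairedI continuous_map_fst)
  from continuous_map_compose[OF this, of euclidean "\<lambda>p. F (fst p) (snd p)"] F
  show "continuous_map ?Z euclidean (\<lambda>p. F (fst p) (snd p + Re (P (fst p) (snd p))))"
    by (simp add: loop_family_def o_def)
  fix x \<theta> assume x: "x \<in> topspace X"
  have "\<theta> + 2 * pi + Re (P x (\<theta> + 2 * pi)) = (\<theta> + Re (P x \<theta>)) + 2 * pi"
    using P x by (simp add: loop_family_def)
  then show "F x (\<theta> + 2 * pi + Re (P x (\<theta> + 2 * pi))) = F x (\<theta> + Re (P x \<theta>))"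
    using F x by (simp only: loop_family_def)
qed

text \<open>
Reparametrization by \<open>\<theta> + Re (P \<theta>)\<close>, the general form of a map of degree one. The displacement
is the real part of a complex loop so that it belongs to a family of the same kind.
\<close>

lemma Ck_family_compose:
  "Ck_family k X F \<Longrightarrow> Ck_family k X P \<Longrightarrow> Ck_family k X (\<lambda>x \<theta>. F x (\<theta> + Re (P x \<theta>)))"
proof (induction k arbitrary: F)
  case (Suc k)
  obtain F' where F: "loop_family X F" "Ck_family k X F'"
    and dF: "\<forall>x\<in>topspace X. \<forall>\<theta>. (F x has_vector_derivative F' x \<theta>) (at \<theta>)"
    using Suc.prems(1) by (rule Ck_family_SucE)
  note dF = dF[rule_format]
  obtain P' where P: "loop_family X P" "Ck_family k X P'"
    and dP: "\<forall>x\<in>topspace X. \<forall>\<theta>. (P x has_vector_derivative P' x \<theta>) (at \<theta>)"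
    using Suc.prems(2) by (rule Ck_family_SucE)
  note dP = dP[rule_format]
  have "Ck_family k X (\<lambda>x \<theta>. (1 + complex_of_real (Re (P' x \<theta>))) * F' x (\<theta> + Re (P x \<theta>)))"
    by (intro Ck_family_mult Ck_family_add Ck_family_constant Suc.IH F Ck_family_SucD[OF Suc.prems(2)]
        Ck_family_bounded_linear[OF bounded_linear_compose[OF bounded_linear_of_real bounded_linear_Re]] P) auto
  moreover have "((\<lambda>\<theta>. F x (\<theta> + Re (P x \<theta>))) has_vector_derivative
      (1 + complex_of_real (Re (P' x \<theta>))) * F' x (\<theta> + Re (P x \<theta>))) (at \<theta>)"
    if "x \<in> topspace X" for x \<theta>
  proof -
    have "((\<lambda>\<theta>. \<theta> + Re (P x \<theta>)) has_vector_derivative 1 + Re (P' x \<theta>)) (at \<theta>)"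
      by (intro has_vector_derivative_add has_vector_derivative_id
          bounded_linear.has_vector_derivative[OF bounded_linear_Re] dP that)
    from vector_diff_chain_at[OF this dF[OF that]]
    show ?thesis by (simp add: o_def scaleR_conv_of_real)
  qed
  ultimately show ?case
    by (rule Ck_family_SucI[OF loop_family_compose[OF F(1) P(1)]])
qed (simp add: loop_family_compose)

lemma Ck_family_sin_cos:
  "Ck_family k X (\<lambda>x \<theta>. of_real (sin \<theta>)) \<and> Ck_family k X (\<lambda>x \<theta>. of_real (cos \<theta>))"
proof (induction k)
  have *: "continuous_map (prod_topology X euclideanreal) euclidean (\<lambda>p. complex_of_real (f (snd p)))"
    if "continuous_on UNIV f" for f
  proof -
    have "continuous_map euclideanreal euclidean (\<lambda>t. complex_of_real (f t))"
      using that by (auto intro!: continuous_intros)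
    from continuous_map_compose[OF continuous_map_snd this] show ?thesis by (simp add: o_def)
  qed
  have l: "loop_family X (\<lambda>x \<theta>. of_real (sin \<theta>))" "loop_family X (\<lambda>x \<theta>. of_real (cos \<theta>))"
    unfolding loop_family_def by (auto intro!: * continuous_intros)
  case 0
  show ?case using l by simp
  case (Suc k)
  have m: "Ck_family k X (\<lambda>x \<theta>. - complex_of_real (sin \<theta>))"
    using Suc Ck_family_bounded_linear[OF bounded_linear_minus[OF bounded_linear_ident]] by blast
  have d: "((\<lambda>\<theta>. complex_of_real (sin \<theta>)) has_vector_derivative of_real (cos \<theta>)) (at \<theta>)"
    "((\<lambda>\<theta>. complex_of_real (cos \<theta>)) has_vector_derivative - of_real (sin \<theta>)) (at \<theta>)" for \<theta>
  proof -
    have "(sin has_real_derivative cos \<theta>) (at \<theta>)" "(cos has_real_derivative - sin \<theta>) (at \<theta>)"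
      by simp_all
    from this[THEN has_vector_derivative_of_real]
    show "((\<lambda>\<theta>. complex_of_real (sin \<theta>)) has_vector_derivative of_real (cos \<theta>)) (at \<theta>)"
    "((\<lambda>\<theta>. complex_of_real (cos \<theta>)) has_vector_derivative - of_real (sin \<theta>)) (at \<theta>)"
      by simp_all
  qed
  show ?case
    using Ck_family_SucI[OF l(1) conjunct2[OF Suc] d(1)] Ck_family_SucI[OF l(2) m d(2)] by blast
qed

lemma Ck_family_pullback:
  assumes h: "continuous_map X Y h"
  shows "Ck_family k Y F \<Longrightarrow> Ck_family k X (\<lambda>x. F (h x))"
proof (induction k arbitrary: F)
  case (Suc k)
  obtain F' where F: "loop_family Y F" "Ck_family k Y F'"
    and dF: "\<forall>y\<in>topspace Y. \<forall>\<theta>. (F y has_vector_derivative F' y \<theta>) (at \<theta>)"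
    using Suc.prems by (rule Ck_family_SucE)
  show ?case
    by (rule Ck_family_SucI[OF loop_family_pullback[OF F(1) h] Suc.IH[OF F(2)]])
      (use dF h in \<open>auto simp: continuous_map_def Pi_iff\<close>)
qed (simp add: loop_family_pullback[OF _ h])

section \<open>Continuous maps into the smooth topology\<close>

lemma theta_deriv_eqI: "(c has_vector_derivative d) (at \<theta>) \<Longrightarrow> theta_deriv c \<theta> = d"
  by (simp add: theta_deriv_def vector_derivative_at)

lemma has_theta_deriv:
  "c differentiable (at \<theta>) \<Longrightarrow> (c has_vector_derivative theta_deriv c \<theta>) (at \<theta>)"
  by (simp add: theta_deriv_def vector_derivative_works)

lemma smooth_loops_has_theta_deriv:
  assumes "c \<in> smooth_loops"
  shows "((theta_deriv ^^ k) c has_vector_derivative (theta_deriv ^^ Suc k) c \<theta>) (at \<theta>)"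
  using assms has_theta_deriv[of "(theta_deriv ^^ k) c" \<theta>] by (simp add: smooth_loops_def)

lemma smooth_loops_continuous:
  assumes "c \<in> smooth_loops"
  shows "continuous_on UNIV ((theta_deriv ^^ k) c)"
  by (meson assms continuous_at_imp_continuous_on has_vector_derivative_continuous smooth_loops_has_theta_deriv)

lemma smooth_loops_periodic:
  assumes c: "c \<in> smooth_loops"
  shows "(theta_deriv ^^ k) c (\<theta> + 2 * pi) = (theta_deriv ^^ k) c \<theta>"
proof (induction k arbitrary: \<theta>)
  case 0
  show ?case using c by (simp add: smooth_loops_def)
next
  case (Suc k)
  let ?f = "(theta_deriv ^^ k) c"
  have "((\<lambda>\<theta>. \<theta> + 2 * pi) has_vector_derivative 1) (at \<theta>)"
    by (auto intro!: derivative_eq_intros)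
  from vector_diff_chain_at[OF this smooth_loops_has_theta_deriv[OF c, of k]]
  have "(?f has_vector_derivative (theta_deriv ^^ Suc k) c (\<theta> + 2 * pi)) (at \<theta>)"
    by (simp add: o_def Suc)
  from theta_deriv_eqI[OF this] show ?case by simp
qed

lemma Ck_family_theta_deriv:
  assumes "Ck_family (Suc k) X F"
  shows "Ck_family k X (\<lambda>x. theta_deriv (F x))"
proof -
  obtain G where "loop_family X F" "Ck_family k X G"
    and dF: "\<forall>x\<in>topspace X. \<forall>\<theta>. (F x has_vector_derivative G x \<theta>) (at \<theta>)"
    using assms by (rule Ck_family_SucE)
  have "G x \<theta> = theta_deriv (F x) \<theta>" if "x \<in> topspace X" for x \<theta>
    using theta_deriv_eqI[of "F x" "G x \<theta>" \<theta>] dF that by simp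
  then show ?thesis
    by (rule Ck_family_cong[OF \<open>Ck_family k X G\<close>])
qed

lemma Ck_family_funpow_theta_deriv:
  assumes "\<And>k. Ck_family k X F"
  shows "Ck_family k X (\<lambda>x. (theta_deriv ^^ j) (F x))"
proof (induction j arbitrary: k)
  case 0
  show ?case using assms by simp
next
  case (Suc j)
  show ?case using Ck_family_theta_deriv[OF Suc[of "Suc k"]] by simp
qed

lemma Ck_family_smooth_loops:
  assumes "\<And>k. Ck_family k X F" and x: "x \<in> topspace X"
  shows "F x \<in> smooth_loops"
  unfolding smooth_loops_def
proof (intro CollectI conjI allI)
  show "F x (\<theta> + 2 * pi) = F x \<theta>" for \<theta>
    using assms(1)[of 0] x by (simp add: loop_family_def)
  show "(theta_deriv ^^ k) (F x) differentiable (at \<theta>)" for k \<theta>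
  proof -
    obtain G where "loop_family X (\<lambda>x. (theta_deriv ^^ k) (F x))" "Ck_family 0 X G"
      and "\<forall>x\<in>topspace X. \<forall>\<theta>. ((theta_deriv ^^ k) (F x) has_vector_derivative G x \<theta>) (at \<theta>)"
      using Ck_family_funpow_theta_deriv[OF assms(1), of "Suc 0" k] by (rule Ck_family_SucE)
    then show ?thesis using x differentiableI_vector by blast
  qed
qed

text \<open>
A uniform bound \<open>\<delta> < \<epsilon>\<close>, rather than a pointwise strict inequality, leaves the room \<open>\<epsilon> - \<delta>\<close> for a
neighbourhood of \<open>d\<close>.
\<close>

lemma Cinf_open_close_deriv:
  assumes c: "c \<in> smooth_loops"
  shows "Cinf_open {d \<in> smooth_loops.
     \<exists>\<delta><\<epsilon>. \<forall>\<theta>. dist ((theta_deriv ^^ k) d \<theta>) ((theta_deriv ^^ k) c \<theta>) \<le> \<delta>}" (is "Cinf_open ?U")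
  unfolding Cinf_open_def
proof (intro conjI ballI)
  show "?U \<subseteq> smooth_loops" by auto
  fix d assume "d \<in> ?U"
  then obtain \<delta> where \<delta>: "\<delta> < \<epsilon>" "\<And>\<theta>. dist ((theta_deriv ^^ k) d \<theta>) ((theta_deriv ^^ k) c \<theta>) \<le> \<delta>" by auto
  have "e \<in> ?U" if "e \<in> smooth_loops"
    "\<forall>j\<le>k. \<forall>\<theta>. dist ((theta_deriv ^^ j) e \<theta>) ((theta_deriv ^^ j) d \<theta>) < (\<epsilon> - \<delta>) / 2" for e
  proof -
    have "dist ((theta_deriv ^^ k) e \<theta>) ((theta_deriv ^^ k) c \<theta>) \<le> (\<epsilon> + \<delta>) / 2" for \<theta>
    proof -
      have "dist ((theta_deriv ^^ k) e \<theta>) ((theta_deriv ^^ k) d \<theta>) < (\<epsilon> - \<delta>) / 2"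
        using that(2) by simp
      then show ?thesis
        using \<delta>(2)[of \<theta>] dist_triangle[of "(theta_deriv ^^ k) e \<theta>" "(theta_deriv ^^ k) c \<theta>" "(theta_deriv ^^ k) d \<theta>"]
        by (simp add: field_simps)
    qed
    moreover have "(\<epsilon> + \<delta>) / 2 < \<epsilon>" using \<delta>(1) by simp
    ultimately show ?thesis using that(1) by blast
  qed
  moreover have "(\<epsilon> - \<delta>) / 2 > 0" using \<delta>(1) by simp
  ultimately show "\<exists>n. \<exists>\<epsilon>'>0. \<forall>e\<in>smooth_loops.
      (\<forall>j\<le>n. \<forall>\<theta>. dist ((theta_deriv ^^ j) e \<theta>) ((theta_deriv ^^ j) d \<theta>) < \<epsilon>') \<longrightarrow> e \<in> ?U"
    by blast
qed

text \<open>
This reduces every continuity statement about the \<open>C\<^sup>\<infinity>\<close>-topology to the calculus of families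
above. In both directions the iterated derivatives form loop families, for which closeness near a
parameter is uniform in the angle.
\<close>

proposition continuous_map_Cinf_topology_iff:
  "continuous_map X Cinf_topology F \<longleftrightarrow> (\<forall>k. Ck_family k X F)"
proof
  assume F: "continuous_map X Cinf_topology F"
  then have sm: "F x \<in> smooth_loops" if "x \<in> topspace X" for x
    using that by (auto simp: continuous_map_def topspace_Cinf_topology)
  have l: "loop_family X (\<lambda>x. (theta_deriv ^^ j) (F x))" for j
  proof (rule loop_familyI_uniform)
    fix x and \<epsilon> :: real assume x: "x \<in> topspace X" and e: "\<epsilon> > 0"
    let ?B = "{d \<in> smooth_loops. \<exists>\<delta><\<epsilon>. \<forall>\<theta>. dist ((theta_deriv ^^ j) d \<theta>) ((theta_deriv ^^ j) (F x) \<theta>) \<le> \<delta>}"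
    have "openin X {y \<in> topspace X. F y \<in> ?B}"
      by (rule openin_continuous_map_preimage[OF F])
        (simp add: openin_Cinf_topology Cinf_open_close_deriv sm x)
    moreover have "x \<in> {y \<in> topspace X. F y \<in> ?B}" using x e sm by auto
    ultimately show "\<exists>U. openin X U \<and> x \<in> U \<and>
        (\<forall>y\<in>U. \<forall>\<theta>. dist ((theta_deriv ^^ j) (F y) \<theta>) ((theta_deriv ^^ j) (F x) \<theta>) < \<epsilon>)"
      by (intro exI[of _ "{y \<in> topspace X. F y \<in> ?B}"]) (auto intro: le_less_trans)
  qed (use sm smooth_loops_periodic smooth_loops_continuous in auto)
  have "Ck_family k X (\<lambda>x. (theta_deriv ^^ j) (F x))" for k j
  proof (induction k arbitrary: j)
    case (Suc k)
    show ?case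
      by (rule Ck_family_SucI[OF l Suc[of "Suc j"]]) (rule smooth_loops_has_theta_deriv[OF sm])
  qed (simp add: l)
  from this[of _ 0] show "\<forall>k. Ck_family k X F" by simp
next
  assume "\<forall>k. Ck_family k X F"
  then have F: "Ck_family k X F" for k by blast
  have sm: "F x \<in> smooth_loops" if "x \<in> topspace X" for x
    using Ck_family_smooth_loops[OF F that] .
  show "continuous_map X Cinf_topology F"
    unfolding continuous_map_def
  proof (intro conjI allI impI)
    show "F \<in> topspace X \<rightarrow> topspace Cinf_topology"
      using sm by (auto simp: topspace_Cinf_topology)
    fix U assume "openin Cinf_topology U"
    then have U: "Cinf_open U" by (simp add: openin_Cinf_topology)
    show "openin X {x \<in> topspace X. F x \<in> U}"
    proof (subst openin_subopen, intro ballI)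
      fix x assume "x \<in> {x \<in> topspace X. F x \<in> U}"
      then have x: "x \<in> topspace X" "F x \<in> U" by auto
      obtain n \<epsilon> where e: "\<epsilon> > 0" and n: "\<And>d. d \<in> smooth_loops \<Longrightarrow>
          (\<forall>k\<le>n. \<forall>\<theta>. dist ((theta_deriv ^^ k) d \<theta>) ((theta_deriv ^^ k) (F x) \<theta>) < \<epsilon>) \<Longrightarrow> d \<in> U"
        using U x(2) unfolding Cinf_open_def by blast
      have "\<forall>k. \<exists>V. openin X V \<and> x \<in> V \<and>
          (\<forall>y\<in>V. \<forall>\<theta>. dist ((theta_deriv ^^ k) (F y) \<theta>) ((theta_deriv ^^ k) (F x) \<theta>) < \<epsilon>)"
        using loop_family_uniform[OF Ck_family_loop_family[OF Ck_family_funpow_theta_deriv[OF F]] x(1) e]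
        by metis
      then obtain V where V: "\<And>k. openin X (V k)" "\<And>k. x \<in> V k"
        "\<And>k y \<theta>. y \<in> V k \<Longrightarrow> dist ((theta_deriv ^^ k) (F y) \<theta>) ((theta_deriv ^^ k) (F x) \<theta>) < \<epsilon>"
        by metis
      have "openin X (\<Inter>k\<in>{..n}. V k)" by (rule openin_INT2) (use V in auto)
      moreover have "F y \<in> U" if "y \<in> (\<Inter>k\<in>{..n}. V k)" for y
      proof (intro n sm)
        show "y \<in> topspace X" using that openin_subset[OF V(1)[of 0]] by auto
      qed (use that V(3) in auto)
      moreover have "(\<Inter>k\<in>{..n}. V k) \<subseteq> topspace X" using openin_subset[OF V(1)] by auto
      ultimately show "\<exists>T. openin X T \<and> x \<in> T \<and> T \<subseteq> {x \<in> topspace X. F x \<in> U}"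
        using V(2) by (intro exI[of _ "\<Inter>k\<in>{..n}. V k"]) auto
    qed
  qed
qed

section \<open>Primitives of loops\<close>

text \<open>
Both integrals are needed because an integral over an interval with reversed endpoints is an integral over the
empty set, hence zero: one term serves positive, the other negative angles.
\<close>

definition primitive :: "(real \<Rightarrow> complex) \<Rightarrow> real \<Rightarrow> complex" where
  "primitive f \<theta> = integral {0..\<theta>} f - integral {\<theta>..0} f"

lemma primitive_eq_integral: "0 \<le> \<theta> \<Longrightarrow> primitive f \<theta> = integral {0..\<theta>} f"
  by (cases "\<theta> = 0") (auto simp: primitive_def)

lemma primitive_has_vector_derivative:
  assumes f: "continuous_on UNIV f"
  shows "(primitive f has_vector_derivative f \<theta>) (at \<theta>)"
proof -
  define N where "N = \<bar>\<theta>\<bar> + 1"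
  have int: "f integrable_on {a..b}" for a b
    by (rule integrable_continuous_real) (use f continuous_on_subset in blast)
  have eq: "integral {-N..t} f - integral {-N..0} f = primitive f t" if "t \<in> {-N<..<N}" for t
  proof (cases "t \<ge> 0")
    case True
    have "integral {-N..0} f + integral {0..t} f = integral {-N..t} f"
      by (rule Henstock_Kurzweil_Integration.integral_combine) (use True int N_def in auto)
    then show ?thesis by (simp add: primitive_eq_integral True algebra_simps)
  next
    case False
    have "integral {-N..t} f + integral {t..0} f = integral {-N..0} f"
      by (rule Henstock_Kurzweil_Integration.integral_combine) (use False int that in auto)
    then show ?thesis using False by (auto simp: primitive_def algebra_simps)
  qed
  have th: "\<theta> \<in> {-N<..<N}" by (auto simp: N_def)
  have "((\<lambda>t. integral {-N..t} f) has_vector_derivative f \<theta>) (at \<theta> within {-N..N})"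
    by (rule integral_has_vector_derivative) (use f continuous_on_subset th in auto)
  then have "((\<lambda>t. integral {-N..t} f) has_vector_derivative f \<theta>) (at \<theta>)"
    using at_within_Icc_at[of "-N" \<theta> N] th by simp
  from has_vector_derivative_diff[OF this has_vector_derivative_const[of "integral {-N..0} f"]]
  have "((\<lambda>t. integral {-N..t} f - integral {-N..0} f) has_vector_derivative f \<theta>) (at \<theta>)"
    by simp
  from has_vector_derivative_transform_within_open[OF this open_greaterThanLessThan th eq]
  show ?thesis .
qed

lemma primitive_periodic:
  assumes f: "continuous_on UNIV f" and per: "\<And>\<theta>. f (\<theta> + 2 * pi) = f \<theta>"
    and zero: "integral {0..2 * pi} f = 0"
  shows "primitive f (\<theta> + 2 * pi) = primitive f \<theta>"
proof -
  have "((\<lambda>\<theta>. primitive f (\<theta> + 2 * pi) - primitive f \<theta>) has_vector_derivative 0) (at \<theta> within UNIV)" for \<theta>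
  proof -
    have "((\<lambda>\<theta>. \<theta> + 2 * pi) has_vector_derivative 1) (at \<theta>)"
      by (auto intro!: derivative_eq_intros)
    from has_vector_derivative_diff[OF vector_diff_chain_at[OF this primitive_has_vector_derivative[OF f]]
        primitive_has_vector_derivative[OF f]]
    show ?thesis by (simp add: o_def per)
  qed
  from has_vector_derivative_zero_constant[OF _ this]
  obtain k where k: "\<And>\<theta>. primitive f (\<theta> + 2 * pi) - primitive f \<theta> = k" by auto
  have "primitive f (0 + 2 * pi) - primitive f 0 = 0"
    by (simp add: primitive_eq_integral zero)
  then show ?thesis using k by (metis eq_iff_diff_eq_0)
qed

text \<open>
Over one period, integration is bounded by \<open>2\<pi>\<close> in the supremum norm; periodicity of the
primitives, which is due to the vanishing integral, extends the estimate to all angles.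
\<close>

lemma loop_family_primitive:
  assumes F: "loop_family X F" and zero: "\<And>x. x \<in> topspace X \<Longrightarrow> integral {0..2 * pi} (F x) = 0"
  shows "loop_family X (\<lambda>x. primitive (F x))"
proof (rule loop_familyI_uniform)
  note cont = loop_family_continuous[OF F]
  have per: "F x (\<theta> + 2 * pi) = F x \<theta>" if "x \<in> topspace X" for x \<theta>
    using F that by (simp add: loop_family_def)
  fix x assume x: "x \<in> topspace X"
  show pp: "primitive (F x) (\<theta> + 2 * pi) = primitive (F x) \<theta>" if "x \<in> topspace X" for x \<theta>
    using primitive_periodic[OF cont per zero] that by blast
  show "continuous_on UNIV (primitive (F x))"
    using primitive_has_vector_derivative[OF cont[OF x]]
    by (meson continuous_at_imp_continuous_on has_vector_derivative_continuous)
  fix \<epsilon> :: real assume e: "\<epsilon> > 0"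
  define \<delta> where "\<delta> = \<epsilon> / (4 * pi)"
  have d: "\<delta> > 0" using e by (simp add: \<delta>_def)
  obtain U where U: "openin X U" "x \<in> U" "\<And>y \<theta>. y \<in> U \<Longrightarrow> dist (F y \<theta>) (F x \<theta>) < \<delta>"
    using loop_family_uniform[OF F x d] by blast
  have "dist (primitive (F y) \<theta>) (primitive (F x) \<theta>) < \<epsilon>" if y: "y \<in> U" for y \<theta>
  proof -
    have yX: "y \<in> topspace X" using U(1) y openin_subset by blast
    obtain \<theta>' where t: "\<theta>' \<in> {0..2 * pi}"
      "\<And>f::real \<Rightarrow> real. (\<And>s. f (s + 2 * pi) = f s) \<Longrightarrow> f \<theta> = f \<theta>'"
      using periodic_reduce by blast
    have int: "F z integrable_on {0..\<theta>'}" if "z \<in> topspace X" for z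
      by (rule integrable_continuous_real) (use cont[OF that] continuous_on_subset in blast)
    have "dist (primitive (F y) \<theta>) (primitive (F x) \<theta>) = dist (primitive (F y) \<theta>') (primitive (F x) \<theta>')"
      using pp x yX by (intro t(2)[of "\<lambda>\<theta>. dist (primitive (F y) \<theta>) (primitive (F x) \<theta>)"]) simp
    also have "\<dots> = norm (integral {0..\<theta>'} (\<lambda>s. F y s - F x s))"
      using t(1) int x yX by (simp add: primitive_eq_integral dist_norm Henstock_Kurzweil_Integration.integral_diff)
    also have "\<dots> \<le> \<delta> * (\<theta>' - 0)"
    proof (rule integral_bound)
      show "continuous_on {0..\<theta>'} (\<lambda>s. F y s - F x s)"
        by (intro continuous_on_diff) (use cont x yX continuous_on_subset in blast)+
      show "norm (F y t - F x t) \<le> \<delta>" for t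
        using U(3)[OF y, of t] by (simp add: dist_norm)
    qed (use t in auto)
    also have "\<dots> \<le> \<delta> * (2 * pi)" using t(1) d by simp
    also have "\<dots> < \<epsilon>" using e by (simp add: \<delta>_def)
    finally show ?thesis .
  qed
  then show "\<exists>U. openin X U \<and> x \<in> U \<and> (\<forall>y\<in>U. \<forall>\<theta>. dist (primitive (F y) \<theta>) (primitive (F x) \<theta>) < \<epsilon>)"
    using U by blast
qed

lemma Ck_family_primitive:
  assumes F: "Ck_family k X F" and zero: "\<And>x. x \<in> topspace X \<Longrightarrow> integral {0..2 * pi} (F x) = 0"
  shows "Ck_family k X (\<lambda>x. primitive (F x))"
proof -
  note l = Ck_family_loop_family[OF F]
  show ?thesis
    by (rule Ck_family_SucD[OF Ck_family_SucI[OF loop_family_primitive[OF l zero] F]])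
      (use primitive_has_vector_derivative loop_family_continuous[OF l] in auto)
qed

lemma eq_primitive_theta_deriv:
  assumes c: "c \<in> smooth_loops"
  shows "c \<theta> = c 0 + primitive (theta_deriv c) \<theta>"
proof -
  have "((\<lambda>\<theta>. c \<theta> - primitive (theta_deriv c) \<theta>) has_vector_derivative 0) (at \<theta> within UNIV)" for \<theta>
    using has_vector_derivative_diff[OF smooth_loops_has_theta_deriv[OF c, of 0]
        primitive_has_vector_derivative[OF smooth_loops_continuous[OF c, of 1]], of \<theta>] by simp
  from has_vector_derivative_zero_constant[OF _ this]
  obtain k where k: "\<And>\<theta>. c \<theta> - primitive (theta_deriv c) \<theta> = k" by auto
  from k[of \<theta>] k[of 0] show ?thesis by (simp add: primitive_eq_integral algebra_simps)
qed

lemma primitive_mult: "primitive (\<lambda>\<theta>. u * f \<theta>) \<theta> = u * primitive f \<theta>"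
  by (simp add: primitive_def right_diff_distrib)

section \<open>The logarithm of the velocity of an immersion\<close>

lemma rotation_degree_exp:
  assumes "\<And>\<theta>. theta_deriv c \<theta> = exp (l \<theta>)" and l: "continuous_on UNIV l"
  shows "rotation_degree c = (l (2 * pi) - l 0) / (2 * of_real pi * \<i>)"
proof -
  have "path (\<lambda>t. l (2 * pi * t))"
    unfolding path_def by (intro continuous_on_compose2[OF l] continuous_intros) auto
  from winding_number_compose_exp[OF this] show ?thesis
    by (simp add: rotation_degree_def assms(1) o_def pathfinish_def pathstart_def)
qed

text \<open>
The logarithm of \<open>c' / c'(0)\<close>, obtained by integrating the logarithmic derivative \<open>c'' / c'\<close>. Unlike
an abstract lift of the logarithm, this formula shows how it depends on \<open>c\<close>.
\<close>

definition log_tangent :: "(real \<Rightarrow> complex) \<Rightarrow> real \<Rightarrow> complex" where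
  "log_tangent c = primitive (\<lambda>\<theta>. theta_deriv (theta_deriv c) \<theta> * inverse (theta_deriv c \<theta>))"

lemma immersions_log_derivative_continuous:
  assumes "c \<in> immersions"
  shows "continuous_on UNIV (\<lambda>\<theta>. theta_deriv (theta_deriv c) \<theta> * inverse (theta_deriv c \<theta>))"
  using assms smooth_loops_continuous[of c 1] smooth_loops_continuous[of c 2]
  by (intro continuous_intros) (auto simp: immersions_def numeral_2_eq_2)

text \<open>
The quotient of the two sides has derivative zero.
\<close>

lemma theta_deriv_eq_exp_log_tangent:
  assumes c: "c \<in> immersions"
  shows "theta_deriv c \<theta> = theta_deriv c 0 * exp (log_tangent c \<theta>)"
proof -
  have sm: "c \<in> smooth_loops" and nz: "\<And>\<theta>. theta_deriv c \<theta> \<noteq> 0" using c by (auto simp: immersions_def)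
  have "((\<lambda>\<theta>. theta_deriv c \<theta> * exp (- log_tangent c \<theta>)) has_vector_derivative 0) (at \<theta> within UNIV)" for \<theta>
  proof -
    let ?q = "theta_deriv (theta_deriv c) \<theta> * inverse (theta_deriv c \<theta>)"
    have 1: "(theta_deriv c has_vector_derivative theta_deriv (theta_deriv c) \<theta>) (at \<theta>)"
      using smooth_loops_has_theta_deriv[OF sm, of 1] by simp
    have "((\<lambda>\<theta>. - log_tangent c \<theta>) has_vector_derivative - ?q) (at \<theta>)"
      unfolding log_tangent_def
      by (intro has_vector_derivative_minus primitive_has_vector_derivative immersions_log_derivative_continuous c)
    from field_vector_diff_chain_at[OF this DERIV_exp]
    have 2: "((\<lambda>\<theta>. exp (- log_tangent c \<theta>)) has_vector_derivative - ?q * exp (- log_tangent c \<theta>)) (at \<theta>)"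
      by (simp add: o_def)
    show ?thesis using has_vector_derivative_mult[OF 1 2] nz[of \<theta>] by (simp add: field_simps)
  qed
  from has_vector_derivative_zero_constant[OF _ this]
  obtain k where k: "\<And>\<theta>. theta_deriv c \<theta> * exp (- log_tangent c \<theta>) = k" by auto
  have "theta_deriv c \<theta> * exp (- log_tangent c \<theta>) = theta_deriv c 0"
    using k[of 0] k[of \<theta>] by (simp add: log_tangent_def primitive_eq_integral)
  then show ?thesis by (simp add: exp_minus field_simps)
qed

text \<open>
The increment of \<open>log_tangent c\<close> over a period is \<open>2\<pi>i\<close> times the degree. So degree zero makes
\<open>log_tangent c\<close> periodic.
\<close>

lemma integral_log_derivative_eq_0:
  assumes c: "c \<in> immersions" and deg: "rotation_degree c = 0"
  shows "integral {0..2 * pi} (\<lambda>\<theta>. theta_deriv (theta_deriv c) \<theta> * inverse (theta_deriv c \<theta>)) = 0"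
proof -
  have nz: "theta_deriv c 0 \<noteq> 0" using c by (auto simp: immersions_def)
  have "continuous_on UNIV (log_tangent c)"
    unfolding log_tangent_def
    using primitive_has_vector_derivative[OF immersions_log_derivative_continuous[OF c]]
    by (meson continuous_at_imp_continuous_on has_vector_derivative_continuous)
  then have "rotation_degree c = ((Ln (theta_deriv c 0) + log_tangent c (2 * pi)) -
      (Ln (theta_deriv c 0) + log_tangent c 0)) / (2 * of_real pi * \<i>)"
    by (intro rotation_degree_exp continuous_intros)
      (simp add: exp_add nz theta_deriv_eq_exp_log_tangent[OF c, symmetric])
  then have "log_tangent c (2 * pi) = log_tangent c 0" using deg by simp
  then show ?thesis by (simp add: log_tangent_def primitive_eq_integral)
qed

lemma topspace_Imm: "topspace (Imm m) = {c \<in> immersions. rotation_degree c = of_int m}"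
  by (auto simp: Imm_def topspace_Cinf_topology immersions_def)

section \<open>Loops whose angle oscillates by more than half a turn\<close>

lemma integral_pos_continuous:
  fixes f :: "real \<Rightarrow> real"
  assumes "continuous_on {a..b} f" "a < b" "\<And>x. x \<in> {a..b} \<Longrightarrow> 0 \<le> f x" "x \<in> {a..b}" "0 < f x"
  shows "0 < integral {a..b} f"
proof -
  have "0 \<le> integral {a..b} f"
    by (rule integral_nonneg) (use assms integrable_continuous_real in auto)
  moreover have "integral {a..b} f \<noteq> 0"
    using integral_eq_0_iff[OF assms(1,2,3)] assms(4,5) by fastforce
  ultimately show ?thesis by simp
qed

lemma norm_cis_diff_le: "norm (cis a - cis b) \<le> \<bar>a - b\<bar>"
proof -
  have "cis a - cis b = cis b * (exp (\<i> * of_real (a - b)) - 1)"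
    by (simp add: cis_mult right_diff_distrib flip: cis_conv_exp of_real_diff)
  then have "norm (cis a - cis b) = 2 * \<bar>sin ((a - b) / 2)\<bar>"
    using dist_exp_i_1[of "a - b"] by (simp add: norm_mult)
  also have "\<dots> \<le> 2 * \<bar>(a - b) / 2\<bar>"
    by (intro mult_left_mono abs_sin_x_le_abs_x) auto
  finally show ?thesis by simp
qed

text \<open>
The angles at which the cosine is not positive form closed intervals of length \<open>\<pi>\<close>, too short to
contain \<open>[a,b]\<close>.
\<close>

lemma cos_pos_in_interval:
  fixes a b \<beta> :: real
  assumes "b - a > pi"
  obtains x where "a \<le> x" "x \<le> b" "cos (x - \<beta>) > 0"
proof -
  \<comment> \<open>\<open>(e - \<pi>, e)\<close> is the first interval of positivity whose right end \<open>e\<close> lies beyond \<open>a\<close>; its left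
    end lies before \<open>b\<close>.\<close>
  define n where "n = \<lfloor>(a - \<beta> - pi / 2) / (2 * pi)\<rfloor> + 1"
  define e where "e = \<beta> + 2 * pi * of_int n + pi / 2"
  have "(a - \<beta> - pi / 2) / (2 * pi) < of_int n" "of_int n \<le> (a - \<beta> - pi / 2) / (2 * pi) + 1"
    unfolding n_def by linarith+
  then have "a - \<beta> - pi / 2 < of_int n * (2 * pi)" "of_int n * (2 * pi) \<le> a - \<beta> - pi / 2 + 2 * pi"
    by (simp_all add: field_simps)
  then have e: "a < e" "e \<le> a + 2 * pi" unfolding e_def by (simp_all add: mult.commute)
  define x where "x = (max a (e - pi) + min b e) / 2"
  have x: "a \<le> x" "x \<le> b" "e - pi < x" "x < e"
    using e assms pi_gt_zero unfolding x_def by (auto simp: max_def min_def)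
  have "cos (x - \<beta>) = cos (x - \<beta> - 2 * pi * of_int n)"
    by (simp add: cos_diff)
  also have "\<dots> > 0"
    by (rule cos_gt_zero_pi) (use x in \<open>auto simp: e_def\<close>)
  finally show thesis using that x by blast
qed

definition wide :: "(real \<Rightarrow> complex) \<Rightarrow> bool" where
  "wide l \<longleftrightarrow> (\<exists>s t. Im (l s) - Im (l t) > pi)"

text \<open>
Continuity suffices for closing up: smoothness enters only when the closing vector is used to
build a curve.
\<close>

definition log_loop :: "(real \<Rightarrow> complex) \<Rightarrow> bool" where
  "log_loop l \<longleftrightarrow> continuous_on UNIV l \<and> (\<forall>\<theta>. l (\<theta> + 2 * pi) = l \<theta>)"

lemma loop_family_log_loop: "loop_family X l \<Longrightarrow> x \<in> topspace X \<Longrightarrow> log_loop (l x)"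
  using loop_family_continuous[of X l x] by (simp add: log_loop_def) (simp add: loop_family_def)

text \<open>
The tangents of a wide loop are not contained in any closed half plane: by the intermediate value
theorem the angle sweeps over an interval longer than \<open>\<pi>\<close>.
\<close>

lemma wide_open_half_plane:
  assumes l: "log_loop l" and wide: "wide l" and v: "v \<noteq> 0"
  obtains \<theta> where "\<theta> \<in> {0..2 * pi}" "v \<bullet> cis (Im (l \<theta>)) > 0"
proof -
  obtain s t where st: "Im (l s) - Im (l t) > pi" using wide by (auto simp: wide_def)
  obtain x where x: "Im (l t) \<le> x" "x \<le> Im (l s)" "cos (x - Arg v) > 0"
    using cos_pos_in_interval[OF st] by metis
  have "connected (range (\<lambda>\<theta>. Im (l \<theta>)))"
    by (intro connected_continuous_image continuous_intros) (use l in \<open>auto simp: log_loop_def\<close>)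
  then have "x \<in> range (\<lambda>\<theta>. Im (l \<theta>))"
    using x(1,2) connectedD_interval by blast
  then obtain \<theta> where \<theta>: "x = Im (l \<theta>)" by auto
  obtain \<theta>' where t: "\<theta>' \<in> {0..2 * pi}"
    "\<And>f::real \<Rightarrow> complex. (\<And>s. f (s + 2 * pi) = f s) \<Longrightarrow> f \<theta> = f \<theta>'"
    using periodic_reduce by blast
  have "l \<theta> = l \<theta>'" by (rule t(2)) (use l in \<open>simp add: log_loop_def\<close>)
  moreover have "v \<bullet> cis x = norm v * cos (x - Arg v)"
  proof -
    have "v = of_real (norm v) * cis (Arg v)" using v by (simp add: Arg_eq cis_conv_exp)
    then have "v \<bullet> cis x = (of_real (norm v) * cis (Arg v)) \<bullet> cis x" by simp
    also have "\<dots> = norm v * cos (x - Arg v)"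
      by (simp add: inner_complex_def cos_diff algebra_simps)
    finally show ?thesis .
  qed
  ultimately show thesis using that[OF t(1)] x(3) v \<theta> by simp
qed

text \<open>
If the angle stayed within \<open>[\<mu> - \<pi>/2, \<mu> + \<pi>/2]\<close>, with \<open>\<mu>\<close> the mean of its extreme values, then the component
of \<open>exp l\<close> in direction \<open>\<mu>\<close> would be nonnegative everywhere and positive at a point where the angle
equals \<open>\<mu>\<close>, so its integral could not vanish.
\<close>

lemma exp_integral_zero_wide:
  assumes l: "log_loop l" and zero: "integral {0..2 * pi} (\<lambda>\<theta>. exp (l \<theta>)) = 0"
  shows "wide l"
proof (rule ccontr)
  assume "\<not> wide l"
  then have nw: "Im (l s) - Im (l t) \<le> pi" for s t by (auto simp: wide_def not_less)
  have lc: "continuous_on A l" for A using l continuous_on_subset by (auto simp: log_loop_def)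
  have ic: "continuous_on {0..2 * pi} (\<lambda>\<theta>. Im (l \<theta>))" by (intro continuous_intros lc)
  obtain s where s: "s \<in> {0..2 * pi}" "\<And>\<theta>. \<theta> \<in> {0..2 * pi} \<Longrightarrow> Im (l \<theta>) \<le> Im (l s)"
    using continuous_attains_sup[OF compact_Icc _ ic] by fastforce
  obtain t where t: "t \<in> {0..2 * pi}" "\<And>\<theta>. \<theta> \<in> {0..2 * pi} \<Longrightarrow> Im (l t) \<le> Im (l \<theta>)"
    using continuous_attains_inf[OF compact_Icc _ ic] by fastforce
  define \<mu> where "\<mu> = (Im (l s) + Im (l t)) / 2"
  have "connected ((\<lambda>\<theta>. Im (l \<theta>)) ` {0..2 * pi})"
    by (rule connected_continuous_image[OF ic]) simp
  moreover have "Im (l t) \<le> \<mu>" "\<mu> \<le> Im (l s)" using s(2)[OF t(1)] by (auto simp: \<mu>_def)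
  ultimately have "\<mu> \<in> (\<lambda>\<theta>. Im (l \<theta>)) ` {0..2 * pi}"
    using connectedD_interval[of "(\<lambda>\<theta>. Im (l \<theta>)) ` {0..2 * pi}" "Im (l t)" "Im (l s)" \<mu>] s(1) t(1) by blast
  then obtain \<theta>0 where \<theta>0: "\<theta>0 \<in> {0..2 * pi}" "Im (l \<theta>0) = \<mu>" by auto
  have eq: "cis \<mu> \<bullet> exp (l \<theta>) = exp (Re (l \<theta>)) * cos (Im (l \<theta>) - \<mu>)" for \<theta>
    by (simp add: inner_complex_def Re_exp Im_exp cos_diff algebra_simps)
  have "0 < integral {0..2 * pi} (\<lambda>\<theta>. cis \<mu> \<bullet> exp (l \<theta>))"
  proof (rule integral_pos_continuous[OF _ _ _ \<theta>0(1)])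
    show "continuous_on {0..2 * pi} (\<lambda>\<theta>. cis \<mu> \<bullet> exp (l \<theta>))" by (intro continuous_intros lc)
    fix \<theta> assume \<theta>: "\<theta> \<in> {0..2 * pi}"
    have "Im (l \<theta>) - \<mu> \<le> pi / 2" "- (pi / 2) \<le> Im (l \<theta>) - \<mu>"
      using s(2)[OF \<theta>] t(2)[OF \<theta>] nw[of s t] unfolding \<mu>_def by argo+
    then have "0 \<le> cos (Im (l \<theta>) - \<mu>)" by (intro cos_ge_zero) auto
    then show "0 \<le> cis \<mu> \<bullet> exp (l \<theta>)" by (simp add: eq)
  qed (auto simp: eq \<theta>0)
  moreover have "integral {0..2 * pi} (\<lambda>\<theta>. cis \<mu> \<bullet> exp (l \<theta>)) = cis \<mu> \<bullet> integral {0..2 * pi} (\<lambda>\<theta>. exp (l \<theta>))"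
  proof -
    have "(\<lambda>\<theta>. exp (l \<theta>)) integrable_on {0..2 * pi}"
      by (intro integrable_continuous_real continuous_intros lc)
    from integral_linear[OF this bounded_linear_inner_right] show ?thesis by (simp add: o_def)
  qed
  ultimately show False using zero by simp
qed

section \<open>Closing up by a change of speed\<close>

text \<open>
Tilting multiplies the speed by a positive factor that favours the direction \<open>w\<close>, and leaves the
tangent angle unchanged. The \<open>energy\<close> is the length of the tilted curve, and its gradient
with respect to \<open>w\<close> is \<open>closing_defect\<close>, the displacement of the tilted curve over one period.
\<close>

definition tilt :: "(real \<Rightarrow> complex) \<Rightarrow> complex \<Rightarrow> real \<Rightarrow> complex" where
  "tilt l w \<theta> = exp (l \<theta> + of_real (w \<bullet> cis (Im (l \<theta>))))"

definition energy :: "(real \<Rightarrow> complex) \<Rightarrow> complex \<Rightarrow> real" where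
  "energy l w = integral {0..2 * pi} (\<lambda>\<theta>. norm (tilt l w \<theta>))"

definition closing_defect :: "(real \<Rightarrow> complex) \<Rightarrow> complex \<Rightarrow> complex" where
  "closing_defect l w = integral {0..2 * pi} (tilt l w)"

lemma tilt_eq: "tilt l w \<theta> = norm (tilt l w \<theta>) *\<^sub>R cis (Im (l \<theta>))"
proof -
  have "exp z = exp (Re z) *\<^sub>R cis (Im z)" for z :: complex
    by (simp add: exp_eq_polar scaleR_conv_of_real)
  from this[of "l \<theta> + of_real (w \<bullet> cis (Im (l \<theta>)))"]
  show ?thesis by (simp add: tilt_def)
qed

lemma norm_tilt_eq: "norm (tilt l w \<theta>) = exp (Re (l \<theta>)) * exp (w \<bullet> cis (Im (l \<theta>)))"
  unfolding tilt_def norm_exp_eq_Re by (simp add: exp_add)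

lemma norm_tilt: "norm (tilt l w \<theta>) = norm (tilt l v \<theta>) * exp ((w - v) \<bullet> cis (Im (l \<theta>)))"
proof -
  have "w \<bullet> cis (Im (l \<theta>)) = v \<bullet> cis (Im (l \<theta>)) + (w - v) \<bullet> cis (Im (l \<theta>))"
    by (simp add: inner_diff_left)
  then show ?thesis unfolding tilt_def norm_exp_eq_Re by (simp only: exp_add plus_complex.sel Re_complex_of_real mult.assoc)
qed

lemma continuous_on_log_loop_snd:
  assumes "log_loop l"
  shows "continuous_on A (\<lambda>p. l (snd p))"
proof -
  have "continuous_on UNIV l" using assms by (simp add: log_loop_def)
  from continuous_on_compose2[OF this continuous_on_snd[OF continuous_on_id], of A]
  show ?thesis by simp
qed

lemma continuous_on_tilt:
  assumes "log_loop l"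
  shows "continuous_on UNIV (\<lambda>p. tilt l (fst p) (snd p))"
  unfolding tilt_def cis_conv_exp by (intro continuous_intros continuous_on_log_loop_snd assms)

lemma continuous_on_tilt_angle:
  assumes "log_loop l"
  shows "continuous_on A (tilt l w)"
proof -
  have "continuous_on A (\<lambda>\<theta>. (w, \<theta>))"
    by (intro continuous_on_Pair continuous_on_const continuous_on_id)
  from continuous_on_compose2[OF continuous_on_tilt[OF assms] this] show ?thesis by simp
qed

lemma continuous_on_energy:
  assumes "log_loop l"
  shows "continuous_on A (energy l)"
proof -
  have "continuous_on (A \<times> cbox 0 (2 * pi)) (\<lambda>(w, \<theta>). norm (tilt l w \<theta>))"
    unfolding split_def by (intro continuous_intros continuous_on_subset[OF continuous_on_tilt[OF assms]]) auto
  from integral_continuous_on_param[OF this] show ?thesis by (simp add: energy_def)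
qed

lemma continuous_on_closing_defect:
  assumes "log_loop l"
  shows "continuous_on A (closing_defect l)"
proof -
  have "continuous_on (A \<times> cbox 0 (2 * pi)) (\<lambda>(w, \<theta>). tilt l w \<theta>)"
    unfolding split_def by (intro continuous_on_subset[OF continuous_on_tilt[OF assms]]) auto
  from integral_continuous_on_param[OF this] show ?thesis by (simp add: closing_defect_def)
qed

lemma energy_pos:
  assumes "log_loop l"
  shows "energy l w > 0"
  unfolding energy_def
proof (rule integral_pos_continuous[where x = 0])
  show "continuous_on {0..2 * pi} (\<lambda>\<theta>. norm (tilt l w \<theta>))"
    by (intro continuous_intros continuous_on_tilt_angle assms)
qed (auto simp: tilt_def)

lemma closing_defect_inner:
  assumes "log_loop l"
  shows "v \<bullet> closing_defect l w = integral {0..2 * pi} (\<lambda>\<theta>. norm (tilt l w \<theta>) * (v \<bullet> cis (Im (l \<theta>))))"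
proof -
  have "v \<bullet> closing_defect l w = integral {0..2 * pi} (\<lambda>\<theta>. v \<bullet> tilt l w \<theta>)"
    unfolding closing_defect_def
    using integral_linear[OF integrable_continuous_real[OF continuous_on_tilt_angle[OF assms]] bounded_linear_inner_right]
    by (simp add: o_def)
  also have "(\<lambda>\<theta>. v \<bullet> tilt l w \<theta>) = (\<lambda>\<theta>. norm (tilt l w \<theta>) * (v \<bullet> cis (Im (l \<theta>))))"
    by (rule ext, subst tilt_eq) simp
  finally show ?thesis .
qed

text \<open>
The exact remainder of the first-order expansion of the energy at \<open>v\<close>. Since \<open>exp x \<ge> 1 + x\<close>, it gives
convexity in the form of tangent inequalities without differentiating under the integral sign.
\<close>

lemma energy_diff:
  assumes l: "log_loop l"
  shows "energy l w - energy l v - (w - v) \<bullet> closing_defect l v =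
     integral {0..2 * pi} (\<lambda>\<theta>. norm (tilt l v \<theta>) *
       (exp ((w - v) \<bullet> cis (Im (l \<theta>))) - 1 - (w - v) \<bullet> cis (Im (l \<theta>))))"
    "continuous_on {0..2 * pi} (\<lambda>\<theta>. norm (tilt l v \<theta>) *
       (exp ((w - v) \<bullet> cis (Im (l \<theta>))) - 1 - (w - v) \<bullet> cis (Im (l \<theta>))))"
proof -
  have lc: "continuous_on {0..2 * pi} l"
    using l continuous_on_subset by (auto simp: log_loop_def)
  have c: "continuous_on {0..2 * pi} (\<lambda>\<theta>. norm (tilt l u \<theta>))"
    "continuous_on {0..2 * pi} (\<lambda>\<theta>. norm (tilt l u \<theta>) * ((w - v) \<bullet> cis (Im (l \<theta>))))" for u
    unfolding cis_conv_exp by (intro continuous_intros continuous_on_tilt_angle l lc)+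
  show "continuous_on {0..2 * pi} (\<lambda>\<theta>. norm (tilt l v \<theta>) *
       (exp ((w - v) \<bullet> cis (Im (l \<theta>))) - 1 - (w - v) \<bullet> cis (Im (l \<theta>))))"
    unfolding cis_conv_exp by (intro continuous_intros continuous_on_tilt_angle l lc)+
  have "(\<lambda>\<theta>. norm (tilt l v \<theta>) * (exp ((w - v) \<bullet> cis (Im (l \<theta>))) - 1 - (w - v) \<bullet> cis (Im (l \<theta>)))) =
    (\<lambda>\<theta>. norm (tilt l w \<theta>) - norm (tilt l v \<theta>) - norm (tilt l v \<theta>) * ((w - v) \<bullet> cis (Im (l \<theta>))))"
    by (simp add: norm_tilt[of l w _ v] algebra_simps)
  then show "energy l w - energy l v - (w - v) \<bullet> closing_defect l v =
     integral {0..2 * pi} (\<lambda>\<theta>. norm (tilt l v \<theta>) *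
       (exp ((w - v) \<bullet> cis (Im (l \<theta>))) - 1 - (w - v) \<bullet> cis (Im (l \<theta>))))"
    by (simp only: energy_def closing_defect_inner[OF l] Henstock_Kurzweil_Integration.integral_diff
        integrable_diff c[THEN integrable_continuous_real])
qed

lemma exp_remainder_nonneg: "0 \<le> exp x - 1 - (x::real)"
  using exp_ge_add_one_self[of x] by linarith

lemma energy_tangent_le:
  assumes l: "log_loop l"
  shows "energy l v + (w - v) \<bullet> closing_defect l v \<le> energy l w"
proof -
  have "0 \<le> integral {0..2 * pi} (\<lambda>\<theta>. norm (tilt l v \<theta>) *
       (exp ((w - v) \<bullet> cis (Im (l \<theta>))) - 1 - (w - v) \<bullet> cis (Im (l \<theta>))))"
    by (intro integral_nonneg integrable_continuous_real energy_diff(2) l mult_nonneg_nonneg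
        norm_ge_zero exp_remainder_nonneg)
  then show ?thesis using energy_diff(1)[OF l, of w v] by simp
qed

text \<open>
Strictness holds because the loop has a tangent with a positive component in
direction \<open>w - v\<close>.
\<close>

lemma energy_tangent_less:
  assumes l: "log_loop l" and "wide l" "w \<noteq> v"
  shows "energy l v + (w - v) \<bullet> closing_defect l v < energy l w"
proof -
  let ?f = "\<lambda>\<theta>. norm (tilt l v \<theta>) *
       (exp ((w - v) \<bullet> cis (Im (l \<theta>))) - 1 - (w - v) \<bullet> cis (Im (l \<theta>)))"
  obtain \<theta> where t: "\<theta> \<in> {0..2 * pi}" "(w - v) \<bullet> cis (Im (l \<theta>)) > 0"
    using wide_open_half_plane[OF assms(1,2), of "w - v"] assms(3) by auto
  have "1 + (w - v) \<bullet> cis (Im (l \<theta>)) < exp ((w - v) \<bullet> cis (Im (l \<theta>)))"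
    using exp_minus_greater[of "- ((w - v) \<bullet> cis (Im (l \<theta>)))"] t(2) by simp
  moreover have "norm (tilt l v \<theta>) > 0" by (simp add: tilt_def)
  ultimately have "?f \<theta> > 0" by (intro mult_pos_pos) auto
  then have "0 < integral {0..2 * pi} ?f"
    by (intro integral_pos_continuous[OF energy_diff(2)[OF l] _ _ t(1)] mult_nonneg_nonneg
        norm_ge_zero exp_remainder_nonneg) auto
  then show ?thesis using energy_diff(1)[OF l, of w v] by simp
qed

text \<open>
For unit vectors \<open>u\<close>, the integral of \<open>exp (Re l)\<close> times the squared positive part of \<open>\<langle>u, cis (Im l)\<rangle>\<close>
is positive, and by compactness bounded below. It controls the energy through
\<open>exp x \<ge> x\<^sup>2 / 2\<close> for \<open>x \<ge> 0\<close>.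
\<close>

lemma energy_coercive:
  assumes l: "log_loop l" and wide: "wide l"
  obtains \<kappa> where "\<kappa> > 0" "\<And>w. \<kappa> * (norm w)\<^sup>2 \<le> energy l w"
proof -
  define q where "q u = integral {0..2 * pi} (\<lambda>\<theta>. exp (Re (l \<theta>)) * (max 0 (u \<bullet> cis (Im (l \<theta>))))\<^sup>2 / 2)" for u
  have c2: "continuous_on UNIV (\<lambda>(u, \<theta>). exp (Re (l \<theta>)) * (max 0 (u \<bullet> cis (Im (l \<theta>))))\<^sup>2 / 2)"
    unfolding split_def cis_conv_exp by (intro continuous_intros continuous_on_log_loop_snd l) auto
  have c1: "continuous_on A (\<lambda>\<theta>. exp (Re (l \<theta>)) * (max 0 (u \<bullet> cis (Im (l \<theta>))))\<^sup>2 / 2)" for u A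
  proof -
    have "continuous_on A (\<lambda>\<theta>. (u, \<theta>))"
      by (intro continuous_on_Pair continuous_on_const continuous_on_id)
    from continuous_on_compose2[OF c2 this] show ?thesis by simp
  qed
  have "continuous_on (sphere 0 1) (\<lambda>u. integral (cbox 0 (2 * pi))
      (\<lambda>\<theta>. exp (Re (l \<theta>)) * (max 0 (u \<bullet> cis (Im (l \<theta>))))\<^sup>2 / 2))"
    by (rule integral_continuous_on_param) (rule continuous_on_subset[OF c2], simp)
  then have cq: "continuous_on (sphere 0 1) q" by (simp add: q_def[abs_def])
  obtain u0 where u0: "u0 \<in> sphere 0 1" "\<And>u. u \<in> sphere 0 1 \<Longrightarrow> q u0 \<le> q u"
    using continuous_attains_inf[OF compact_sphere _ cq] by (metis sphere_eq_empty not_one_less_zero)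
  have "u0 \<noteq> 0" using u0(1) by auto
  then obtain \<theta> where t: "\<theta> \<in> {0..2 * pi}" "u0 \<bullet> cis (Im (l \<theta>)) > 0"
    using wide_open_half_plane[OF l wide] by blast
  have pos: "q u0 > 0"
    unfolding q_def by (rule integral_pos_continuous[OF c1 _ _ t(1)]) (use t(2) in auto)
  have "q u0 * (norm w)\<^sup>2 \<le> energy l w" for w
  proof (cases "w = 0")
    case True
    then show ?thesis using energy_pos[OF l, of w] by simp
  next
    case False
    define s where "s = norm w"
    have s: "s > 0" "w = s *\<^sub>R sgn w" using False by (auto simp: s_def sgn_div_norm)
    have "q u0 * s\<^sup>2 \<le> q (sgn w) * s\<^sup>2"
      using u0(2)[of "sgn w"] False by (simp add: norm_sgn mult_right_mono)
    also have "\<dots> = integral {0..2 * pi} (\<lambda>\<theta>. exp (Re (l \<theta>)) * (max 0 (sgn w \<bullet> cis (Im (l \<theta>))))\<^sup>2 / 2 * s\<^sup>2)"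
      unfolding q_def by (rule integral_mult_left[symmetric])
    also have "\<dots> \<le> energy l w"
      unfolding energy_def
    proof (rule integral_le)
      show "(\<lambda>\<theta>. exp (Re (l \<theta>)) * (max 0 (sgn w \<bullet> cis (Im (l \<theta>))))\<^sup>2 / 2 * s\<^sup>2) integrable_on {0..2 * pi}"
        by (intro integrable_continuous_real continuous_on_mult c1 continuous_intros)
      show "(\<lambda>\<theta>. norm (tilt l w \<theta>)) integrable_on {0..2 * pi}"
        by (intro integrable_continuous_real continuous_intros continuous_on_tilt_angle l)
      fix \<theta>
      let ?y = "sgn w \<bullet> cis (Im (l \<theta>))"
      have "(max 0 ?y)\<^sup>2 / 2 * s\<^sup>2 = (max 0 (s * ?y))\<^sup>2 / 2"
        using s(1) by (auto simp: max_def power_mult_distrib mult_le_0_iff zero_le_mult_iff)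
      also have "\<dots> \<le> exp (s * ?y)"
        using exp_lower_Taylor_quadratic[of "s * ?y"] by (cases "0 \<le> s * ?y") (auto simp: max_def)
      also have "s * ?y = w \<bullet> cis (Im (l \<theta>))"
        by (subst (2) s(2)) simp
      finally have "exp (Re (l \<theta>)) * ((max 0 ?y)\<^sup>2 / 2 * s\<^sup>2) \<le> exp (Re (l \<theta>)) * exp (w \<bullet> cis (Im (l \<theta>)))"
        by (rule mult_left_mono) simp
      then show "exp (Re (l \<theta>)) * (max 0 ?y)\<^sup>2 / 2 * s\<^sup>2 \<le> norm (tilt l w \<theta>)"
        by (simp add: norm_tilt_eq mult.assoc)
    qed
    finally show ?thesis by (simp add: s_def)
  qed
  then show thesis using that pos by blast
qed

lemma energy_minimizer_exists:
  assumes l: "log_loop l" and wide: "wide l"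
  obtains v where "\<And>w. energy l v \<le> energy l w"
proof -
  obtain \<kappa> where k: "\<kappa> > 0" "\<And>w. \<kappa> * (norm w)\<^sup>2 \<le> energy l w"
    using energy_coercive[OF l wide] by blast
  define R where "R = sqrt (energy l 0 / \<kappa>)"
  have R: "R \<ge> 0" "\<kappa> * R\<^sup>2 = energy l 0" using k(1) energy_pos[OF l, of 0] by (auto simp: R_def)
  obtain v where v: "v \<in> cball 0 R" "\<And>w. w \<in> cball 0 R \<Longrightarrow> energy l v \<le> energy l w"
    using continuous_attains_inf[OF compact_cball _ continuous_on_energy[OF l], of 0 R] R(1) by auto
  have "energy l v \<le> energy l w" for w
  proof (cases "norm w \<le> R")
    case False
    then have "\<kappa> * R\<^sup>2 \<le> \<kappa> * (norm w)\<^sup>2"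
      using R(1) k(1) by (intro mult_left_mono power_mono) auto
    with R(2) k(2)[of w] v(2)[of 0] R(1) show ?thesis by auto
  qed (use v in auto)
  then show thesis using that by blast
qed

text \<open>
The tangent inequality at \<open>v + s u\<close>, compared with minimality at \<open>v\<close>, shows that the gradient at \<open>v + s u\<close> has a
nonnegative component along \<open>u\<close>; let \<open>s\<close> tend to zero and take \<open>u\<close> opposite to the gradient.
\<close>

lemma minimizer_closing_defect:
  assumes l: "log_loop l" and min: "\<And>w. energy l v \<le> energy l w"
  shows "closing_defect l v = 0"
proof -
  have ge: "0 \<le> u \<bullet> closing_defect l v" for u
  proof (rule tendsto_lowerbound)
    have "((\<lambda>s. closing_defect l (v + s *\<^sub>R u)) \<longlongrightarrow> closing_defect l (v + 0 *\<^sub>R u)) (at_right 0)"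
      using continuous_on_closing_defect[OF l, of UNIV]
      by (intro isCont_tendsto_compose[of _ "closing_defect l"] tendsto_intros)
        (auto simp: continuous_on_eq_continuous_at)
    then show "((\<lambda>s. u \<bullet> closing_defect l (v + s *\<^sub>R u)) \<longlongrightarrow> u \<bullet> closing_defect l v) (at_right 0)"
      by (intro tendsto_intros) simp
    have "0 \<le> u \<bullet> closing_defect l (v + s *\<^sub>R u)" if "s > 0" for s
    proof -
      have "0 \<le> s * (u \<bullet> closing_defect l (v + s *\<^sub>R u))"
        using energy_tangent_le[OF l, of "v + s *\<^sub>R u" v] min[of "v + s *\<^sub>R u"] by simp
      then show ?thesis using that by (simp add: zero_le_mult_iff)
    qed
    then show "\<forall>\<^sub>F s in at_right 0. 0 \<le> u \<bullet> closing_defect l (v + s *\<^sub>R u)"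
      by (auto simp: eventually_at_right_less eventually_mono[OF eventually_at_right_less])
  qed simp
  have "closing_defect l v \<bullet> closing_defect l v \<le> 0" using ge[of "- closing_defect l v"] by simp
  then show ?thesis by (metis order_antisym inner_ge_zero inner_eq_zero_iff)
qed

lemma closing_defect_zero_less:
  assumes "log_loop l" "wide l" "closing_defect l v = 0" "w \<noteq> v"
  shows "energy l v < energy l w"
  using energy_tangent_less[OF assms(1,2,4)] assms(3) by simp

definition closing_vector :: "(real \<Rightarrow> complex) \<Rightarrow> complex" where
  "closing_vector l = (THE v. closing_defect l v = 0)"

lemma closing_vector_eqI:
  assumes "log_loop l" "wide l" "closing_defect l v = 0"
  shows "closing_vector l = v"
  unfolding closing_vector_def
proof (rule the_equality)
  fix w assume "closing_defect l w = 0"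
  with assms show "w = v"
    using closing_defect_zero_less[of l v w] closing_defect_zero_less[of l w v] by fastforce
qed (rule assms)

lemma closing_defect_closing_vector:
  assumes "log_loop l" "wide l"
  shows "closing_defect l (closing_vector l) = 0"
proof -
  obtain v where "\<And>w. energy l v \<le> energy l w"
    using energy_minimizer_exists[OF assms] by blast
  then have "closing_defect l v = 0" using minimizer_closing_defect[OF assms(1)] by blast
  then show ?thesis using closing_vector_eqI[OF assms] by simp
qed

text \<open>
As \<open>cis\<close> does not increase distances, the exponents in the two energies differ by at most
\<open>\<delta> + R \<delta>\<close>. A multiplicative estimate is what the comparison of minima below can absorb.
\<close>

lemma energy_perturb:
  assumes l: "log_loop l" and m: "log_loop m" and d: "\<And>\<theta>. dist (l \<theta>) (m \<theta>) \<le> \<delta>"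
    and w: "norm w \<le> R" and \<eta>: "(1 + R) * \<delta> \<le> \<eta>"
  shows "energy l w \<le> exp \<eta> * energy m w"
proof -
  have "energy l w \<le> integral {0..2 * pi} (\<lambda>\<theta>. exp \<eta> * norm (tilt m w \<theta>))"
    unfolding energy_def
  proof (intro integral_le integrable_continuous_real continuous_intros continuous_on_tilt_angle l m)
    fix \<theta>
    have 1: "Re (l \<theta>) - Re (m \<theta>) \<le> \<delta>" "\<bar>Im (l \<theta>) - Im (m \<theta>)\<bar> \<le> \<delta>"
      using d[of \<theta>] abs_Re_le_cmod[of "l \<theta> - m \<theta>"] abs_Im_le_cmod[of "l \<theta> - m \<theta>"]
      by (auto simp: dist_norm)
    have "w \<bullet> (cis (Im (l \<theta>)) - cis (Im (m \<theta>))) \<le> norm w * norm (cis (Im (l \<theta>)) - cis (Im (m \<theta>)))"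
      by (rule norm_cauchy_schwarz)
    also have "\<dots> \<le> R * \<delta>"
      using w 1 norm_cis_diff_le[of "Im (l \<theta>)" "Im (m \<theta>)"] order_trans[OF norm_ge_zero w]
      by (intro mult_mono) auto
    finally have "Re (l \<theta>) + w \<bullet> cis (Im (l \<theta>)) \<le> \<eta> + (Re (m \<theta>) + w \<bullet> cis (Im (m \<theta>)))"
      using 1 \<eta> by (simp add: inner_diff_right algebra_simps)
    then show "norm (tilt l w \<theta>) \<le> exp \<eta> * norm (tilt m w \<theta>)"
      by (simp add: tilt_def flip: exp_add)
  qed
  then show ?thesis by (simp add: energy_def)
qed

text \<open>
A criterion for the minimizer to lie near \<open>v\<close>: if the energy on a sphere around \<open>v\<close> exceeds the
energy at \<open>v\<close>, then by convexity the minimizer lies inside. The witness \<open>w\<close> lies on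
the segment from \<open>v\<close> to the minimizer.
\<close>

lemma closing_vector_near:
  assumes m: "log_loop m" "wide m" and "v \<notin> ball (closing_vector m) \<epsilon>" "\<epsilon> > 0"
  obtains w where "w \<in> sphere v \<epsilon>" "energy m w \<le> energy m v"
proof -
  let ?z = "closing_vector m"
  define w where "w = v + (\<epsilon> / dist v ?z) *\<^sub>R (?z - v)"
  have D: "dist v ?z \<ge> \<epsilon>" using assms(3) by (simp add: dist_commute)
  have "v \<noteq> ?z" using D assms(4) by auto
  then have "w \<in> sphere v \<epsilon>" using assms(4) by (simp add: w_def dist_norm norm_minus_commute)
  moreover have "energy m w \<le> energy m v"
  proof (rule ccontr)
    let ?G = "closing_defect m w" and ?r = "\<epsilon> / dist v ?z"
    assume "\<not> energy m w \<le> energy m v"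
    then have "(v - w) \<bullet> ?G < 0" using energy_tangent_le[OF m(1), of w v] by simp
    moreover have "v - w = ?r *\<^sub>R (v - ?z)" by (simp add: w_def algebra_simps)
    moreover have r: "0 < ?r" "?r \<le> 1" using D assms(4) \<open>v \<noteq> ?z\<close> by (simp_all add: divide_le_eq)
    ultimately have "?r * ((v - ?z) \<bullet> ?G) < 0" by (simp only: inner_scaleR_left)
    with r(1) have neg: "(v - ?z) \<bullet> ?G < 0" using mult_less_cancel_left_pos[of ?r _ 0] by simp
    have "?z - w = (?r - 1) *\<^sub>R (v - ?z)" by (simp add: w_def algebra_simps)
    then have "(?z - w) \<bullet> ?G \<ge> 0" using r neg by (simp add: mult_nonpos_nonpos)
    then have "energy m w \<le> energy m ?z" using energy_tangent_le[OF m(1), of w ?z] by simp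
    moreover have "energy m ?z \<le> energy m v"
      using closing_defect_zero_less[OF m closing_defect_closing_vector[OF m], of v] by (cases "v = ?z") auto
    ultimately show False using \<open>\<not> energy m w \<le> energy m v\<close> by simp
  qed
  ultimately show thesis using that by blast
qed

text \<open>
On a small sphere around the minimizer for the parameter \<open>x\<close> the energy is at least \<open>b\<close>, and \<open>b\<close> is larger
than the minimum \<open>a\<close>. For nearby parameters the energies change by a factor too small to close
this gap, so the minimizers remain inside the sphere.
\<close>

lemma continuous_map_closing_vector:
  assumes l: "loop_family X l" and wide: "\<And>x. x \<in> topspace X \<Longrightarrow> wide (l x)"
  shows "continuous_map X euclidean (\<lambda>x. closing_vector (l x))"
  unfolding continuous_map_euclidean_atin tendsto_iff
proof (intro ballI allI impI)
  note ll = loop_family_log_loop[OF l]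
  fix x and \<epsilon> :: real assume x: "x \<in> topspace X" and e: "\<epsilon> > 0"
  let ?v = "closing_vector (l x)"
  obtain w0 where w0: "w0 \<in> sphere ?v \<epsilon>" "\<And>w. w \<in> sphere ?v \<epsilon> \<Longrightarrow> energy (l x) w0 \<le> energy (l x) w"
    using continuous_attains_inf[OF compact_sphere _ continuous_on_energy[OF ll[OF x]], of ?v \<epsilon>] e
    by (metis sphere_eq_empty less_asym)
  define a b where "a = energy (l x) ?v" and "b = energy (l x) w0"
  have "w0 \<noteq> ?v" using w0(1) e by auto
  then have ab: "0 < a" "a < b"
    using closing_defect_zero_less[OF ll[OF x] wide[OF x] closing_defect_closing_vector[OF ll[OF x] wide[OF x]], of w0]
      energy_pos[OF ll[OF x]] by (auto simp: a_def b_def)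
  \<comment> \<open>Two factors \<open>exp \<eta>\<close> are lost in the comparison below; a third
    of the logarithm keeps the inequality strict.\<close>
  define \<eta> where "\<eta> = ln (b / a) / 3"
  have \<eta>: "\<eta> > 0" "exp \<eta> * (exp \<eta> * a) < b"
  proof -
    show "\<eta> > 0" using ab by (simp add: \<eta>_def)
    then have "exp \<eta> * exp \<eta> < exp (3 * \<eta>)" by (simp flip: exp_add)
    also have "\<dots> = b / a" using ab by (simp add: \<eta>_def)
    finally show "exp \<eta> * (exp \<eta> * a) < b" using ab by (simp add: field_simps)
  qed
  define R where "R = norm ?v + \<epsilon>"
  define \<delta> where "\<delta> = \<eta> / (1 + R)"
  have R: "1 + R > 0" using e norm_ge_zero[of ?v] unfolding R_def by linarith
  then have d: "\<delta> > 0" "(1 + R) * \<delta> \<le> \<eta>" using \<eta>(1) by (auto simp: \<delta>_def)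
  obtain U where U: "openin X U" "x \<in> U" "\<And>y \<theta>. y \<in> U \<Longrightarrow> dist (l y \<theta>) (l x \<theta>) < \<delta>"
    using loop_family_uniform[OF l x d(1)] by blast
  have "dist (closing_vector (l y)) ?v < \<epsilon>" if y: "y \<in> U" for y
  proof (rule ccontr)
    assume far: "\<not> dist (closing_vector (l y)) ?v < \<epsilon>"
    have yX: "y \<in> topspace X" using U(1) y openin_subset by blast
    have near: "dist (l y \<theta>) (l x \<theta>) \<le> \<delta>" "dist (l x \<theta>) (l y \<theta>) \<le> \<delta>" for \<theta>
      using U(3)[OF y, of \<theta>] by (simp_all add: dist_commute)
    obtain w where w: "w \<in> sphere ?v \<epsilon>" "energy (l y) w \<le> energy (l y) ?v"
      using closing_vector_near[OF ll[OF yX] wide[OF yX], of ?v \<epsilon>] far e by auto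
    have nw: "norm w \<le> R"
      using w(1) norm_triangle_ineq[of ?v "w - ?v"] by (simp add: R_def dist_norm norm_minus_commute)
    have nv: "norm ?v \<le> R" using e by (simp add: R_def)
    have "b \<le> energy (l x) w" using w0(2)[OF w(1)] by (simp add: b_def)
    also have "\<dots> \<le> exp \<eta> * energy (l y) w"
      by (rule energy_perturb[OF ll[OF x] ll[OF yX] near(2) nw d(2)])
    also have "\<dots> \<le> exp \<eta> * energy (l y) ?v" using w(2) by simp
    also have "\<dots> \<le> exp \<eta> * (exp \<eta> * energy (l x) ?v)"
      using energy_perturb[OF ll[OF yX] ll[OF x] near(1) nv d(2)] by simp
    also have "\<dots> < b" using \<eta>(2) by (simp add: a_def)
    finally show False by simp
  qed
  then show "\<forall>\<^sub>F y in atin X x. dist (closing_vector (l y)) ?v < \<epsilon>"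
    unfolding eventually_atin using U by blast
qed

section \<open>Closed curves with a prescribed tangent angle\<close>

text \<open>
The curve with starting point \<open>p\<close> whose tangent angle is that of \<open>l\<close>, rotated by \<open>u\<close>, and whose speed
is corrected so that the curve closes up.
\<close>

definition closed_curve :: "complex \<Rightarrow> complex \<Rightarrow> (real \<Rightarrow> complex) \<Rightarrow> real \<Rightarrow> complex" where
  "closed_curve p u l \<theta> = p + u * primitive (tilt l (closing_vector l)) \<theta>"

lemma theta_deriv_closed_curve:
  assumes "log_loop l"
  shows "theta_deriv (closed_curve p u l) \<theta> = u * tilt l (closing_vector l) \<theta>"
proof (rule theta_deriv_eqI)
  have "(primitive (tilt l (closing_vector l)) has_vector_derivative tilt l (closing_vector l) \<theta>) (at \<theta>)"
    by (intro primitive_has_vector_derivative continuous_on_tilt_angle assms)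
  from has_vector_derivative_add[OF has_vector_derivative_const[of p]
      bounded_linear.has_vector_derivative[OF bounded_linear_mult_right this, of u]]
  show "(closed_curve p u l has_vector_derivative u * tilt l (closing_vector l) \<theta>) (at \<theta>)"
    by (simp add: closed_curve_def[abs_def])
qed

lemma closed_curve_degree_0:
  assumes "log_loop l" "u \<noteq> 0"
  shows "rotation_degree (closed_curve p u l) = 0"
proof -
  let ?e = "\<lambda>\<theta>. Ln u + (l \<theta> + of_real (closing_vector l \<bullet> cis (Im (l \<theta>))))"
  have "rotation_degree (closed_curve p u l) = (?e (2 * pi) - ?e 0) / (2 * of_real pi * \<i>)"
  proof (rule rotation_degree_exp)
    show "theta_deriv (closed_curve p u l) \<theta> = exp (?e \<theta>)" for \<theta>
      unfolding theta_deriv_closed_curve[OF assms(1)] tilt_def exp_add[of "Ln u"] using assms(2) by simp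
    show "continuous_on UNIV ?e"
      unfolding cis_conv_exp by (intro continuous_intros) (use assms(1) in \<open>auto simp: log_loop_def\<close>)
  qed
  moreover have "l (2 * pi) = l 0" using assms(1) by (auto simp: log_loop_def dest: spec[of _ 0])
  ultimately show ?thesis by simp
qed

lemma Ck_family_tilt:
  assumes l: "Ck_family k X l" and v: "continuous_map X euclidean v"
  shows "Ck_family k X (\<lambda>x. tilt (l x) (v x))"
proof -
  have re: "bounded_linear (\<lambda>z. complex_of_real (Re z))"
    by (rule bounded_linear_compose[OF bounded_linear_of_real bounded_linear_Re])
  have im: "bounded_linear (\<lambda>z. \<i> * complex_of_real (Im z))"
    by (intro bounded_linear_compose[OF bounded_linear_mult_right]
        bounded_linear_compose[OF bounded_linear_of_real bounded_linear_Im])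
  have "continuous_map X euclidean (\<lambda>x. cnj (v x))"
    using v by (auto simp: continuous_map_euclidean_atin intro: tendsto_cnj)
  then have "Ck_family k X (\<lambda>x \<theta>. exp (l x \<theta> + of_real (Re (cnj (v x) * exp (\<i> * of_real (Im (l x \<theta>)))))))"
    by (intro Ck_family_exp Ck_family_add Ck_family_bounded_linear[OF re] Ck_family_mult
        Ck_family_constant Ck_family_bounded_linear[OF im] l)
  then show ?thesis
    by (rule Ck_family_cong) (simp add: tilt_def inner_complex_def cis_conv_exp)
qed

proposition continuous_map_closed_curve:
  assumes l: "\<And>k. Ck_family k X l" and wide: "\<And>x. x \<in> topspace X \<Longrightarrow> wide (l x)"
    and p: "continuous_map X euclidean p" and u: "continuous_map X euclidean u"
    and nz: "\<And>x. x \<in> topspace X \<Longrightarrow> u x \<noteq> 0"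
  shows "continuous_map X (Imm 0) (\<lambda>x. closed_curve (p x) (u x) (l x))"
proof -
  note lf = Ck_family_loop_family[OF l]
  note ll = loop_family_log_loop[OF lf]
  have fam: "Ck_family k X (\<lambda>x. closed_curve (p x) (u x) (l x))" for k
  proof -
    have "Ck_family k X (\<lambda>x. tilt (l x) (closing_vector (l x)))"
      by (rule Ck_family_tilt[OF l continuous_map_closing_vector[OF lf wide]])
    moreover have "integral {0..2 * pi} (tilt (l x) (closing_vector (l x))) = 0" if "x \<in> topspace X" for x
      using closing_defect_closing_vector[OF ll[OF that] wide[OF that]] by (simp add: closing_defect_def)
    ultimately have "Ck_family k X (\<lambda>x. primitive (tilt (l x) (closing_vector (l x))))"
      by (rule Ck_family_primitive)
    then have "Ck_family k X (\<lambda>x \<theta>. p x + u x * primitive (tilt (l x) (closing_vector (l x))) \<theta>)"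
      by (intro Ck_family_add Ck_family_mult Ck_family_constant p u)
    then show ?thesis by (simp add: closed_curve_def[abs_def])
  qed
  have "closed_curve (p x) (u x) (l x) \<in> immersions" if "x \<in> topspace X" for x
    using Ck_family_smooth_loops[OF fam that] nz[OF that]
    by (simp add: immersions_def theta_deriv_closed_curve[OF ll[OF that]]) (simp add: tilt_def)
  then show ?thesis
    using fam closed_curve_degree_0[OF ll nz]
    by (auto simp: Imm_def continuous_map_in_subtopology continuous_map_Cinf_topology_iff)
qed

lemma Ck_family_Imm: "Ck_family k (Imm m) (\<lambda>c. c)"
proof -
  have "continuous_map (Imm m) Cinf_topology (\<lambda>c. c)"
    by (simp add: Imm_def continuous_map_from_subtopology)
  then show ?thesis using continuous_map_Cinf_topology_iff by blast
qed

lemma Ck_family_log_tangent: "Ck_family k (Imm 0) log_tangent"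
proof -
  have 1: "Ck_family k (Imm 0) theta_deriv" "Ck_family k (Imm 0) (\<lambda>c. theta_deriv (theta_deriv c))" for k
    using Ck_family_theta_deriv[OF Ck_family_Imm[of "Suc k" 0]]
      Ck_family_theta_deriv[OF Ck_family_theta_deriv[OF Ck_family_Imm[of "Suc (Suc k)" 0]]] by simp_all
  have "Ck_family k (Imm 0) (\<lambda>c \<theta>. theta_deriv (theta_deriv c) \<theta> * inverse (theta_deriv c \<theta>))"
    by (intro Ck_family_mult Ck_family_inverse 1) (auto simp: topspace_Imm immersions_def)
  moreover have "integral {0..2 * pi} (\<lambda>\<theta>. theta_deriv (theta_deriv c) \<theta> * inverse (theta_deriv c \<theta>)) = 0"
    if "c \<in> topspace (Imm 0)" for c
    using that by (intro integral_log_derivative_eq_0) (simp_all add: topspace_Imm)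
  ultimately show ?thesis
    unfolding log_tangent_def[abs_def] by (rule Ck_family_primitive)
qed

text \<open>
An immersion of degree \<open>0\<close> is recovered from its logarithm: it is closed already, so its closing
vector is \<open>0\<close> and the speed is not altered.
\<close>

lemma Imm_log_tangent:
  assumes "c \<in> topspace (Imm 0)"
  shows "log_loop (log_tangent c)" "wide (log_tangent c)"
    "closed_curve (c 0) (theta_deriv c 0) (log_tangent c) = c"
proof -
  have c: "c \<in> immersions" "c \<in> smooth_loops" using assms by (auto simp: topspace_Imm immersions_def)
  have nz: "theta_deriv c 0 \<noteq> 0" using c by (simp add: immersions_def)
  show ll: "log_loop (log_tangent c)"
    using loop_family_log_loop[OF Ck_family_loop_family[OF Ck_family_log_tangent[of 0]] assms] .
  have "c (2 * pi) = c 0" using smooth_loops_periodic[OF c(2), of 0 0] by simp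
  then have "primitive (theta_deriv c) (2 * pi) = 0"
    using eq_primitive_theta_deriv[OF c(2), of "2 * pi"] by simp
  then have "integral {0..2 * pi} (theta_deriv c) = 0" by (simp add: primitive_eq_integral)
  moreover have td: "theta_deriv c = (\<lambda>\<theta>. theta_deriv c 0 * exp (log_tangent c \<theta>))"
    using theta_deriv_eq_exp_log_tangent[OF c(1)] by blast
  ultimately have "integral {0..2 * pi} (\<lambda>\<theta>. theta_deriv c 0 * exp (log_tangent c \<theta>)) = 0" by simp
  then have zero: "integral {0..2 * pi} (\<lambda>\<theta>. exp (log_tangent c \<theta>)) = 0" using nz by simp
  then show wide: "wide (log_tangent c)" by (rule exp_integral_zero_wide[OF ll])
  have t0: "tilt (log_tangent c) 0 = (\<lambda>\<theta>. exp (log_tangent c \<theta>))" by (simp add: tilt_def[abs_def])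
  have "closing_vector (log_tangent c) = 0"
    by (rule closing_vector_eqI[OF ll wide]) (simp add: closing_defect_def t0 zero)
  then have "closed_curve (c 0) (theta_deriv c 0) (log_tangent c) \<theta>
      = c 0 + primitive (\<lambda>\<theta>. theta_deriv c 0 * exp (log_tangent c \<theta>)) \<theta>" for \<theta>
    by (simp add: closed_curve_def t0 primitive_mult)
  then show "closed_curve (c 0) (theta_deriv c 0) (log_tangent c) = c"
    unfolding td[symmetric] eq_primitive_theta_deriv[OF c(2), symmetric] by (rule ext)
qed

section \<open>Contracting the wide loops\<close>

definition fold_angle :: "real \<Rightarrow> real \<Rightarrow> real" where
  "fold_angle a \<theta> = \<theta> + a * sin \<theta>"

text \<open>
The map differs from the identity by at most \<open>|a|\<close>.
\<close>

lemma fold_angle_surj: "\<exists>\<theta>. fold_angle a \<theta> = y"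
proof -
  have b: "\<bar>a * sin \<theta>\<bar> \<le> \<bar>a\<bar>" for \<theta>
    using mult_left_mono[OF abs_sin_le_one[of \<theta>], of "\<bar>a\<bar>"] by (simp add: abs_mult)
  have "\<exists>\<theta>\<ge>y - \<bar>a\<bar>. \<theta> \<le> y + \<bar>a\<bar> \<and> fold_angle a \<theta> = y"
    by (rule IVT') (use b[of "y - \<bar>a\<bar>"] b[of "y + \<bar>a\<bar>"] in
        \<open>auto simp: fold_angle_def abs_le_iff intro!: continuous_intros\<close>)
  then show ?thesis by blast
qed

lemma wide_fold_angle:
  assumes "wide l"
  shows "wide (\<lambda>\<theta>. l (fold_angle a \<theta>))"
  using assms fold_angle_surj unfolding wide_def by metis

text \<open>
With \<open>a = 3\<pi>/2\<close> the folding map already takes \<open>[0, \<pi>/2]\<close> onto \<open>[0, 2\<pi>]\<close>, where the sine is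
nonnegative, and likewise \<open>[3\<pi>/2, 2\<pi>]\<close>, where the sine is nonpositive. So preimages can be chosen where
the added term helps.
\<close>

lemma wide_fold_angle_add_sin:
  assumes l: "log_loop l" and "wide l" and s: "s \<ge> 0"
  shows "wide (\<lambda>\<theta>. l (fold_angle (3 * pi / 2) \<theta>) + \<i> * of_real (s * sin \<theta>))"
proof -
  let ?\<phi> = "fold_angle (3 * pi / 2)"
  have s32: "sin (3 * pi / 2) = -1" using sin_3over2_pi by (simp add: mult.commute)
  have cont: "continuous_on A ?\<phi>" for A unfolding fold_angle_def[abs_def] by (intro continuous_intros)
  obtain y1 y2 where y: "Im (l y1) - Im (l y2) > pi" using assms(2) by (auto simp: wide_def)
  have per: "\<And>s. l (s + 2 * pi) = l s" using l by (simp add: log_loop_def)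
  obtain z1 where z1: "z1 \<in> {0..2 * pi}" "l y1 = l z1"
    by (rule periodic_reduce[of y1, where 'a = complex]) (use per in blast)
  obtain z2 where z2: "z2 \<in> {0..2 * pi}" "l y2 = l z2"
    by (rule periodic_reduce[of y2, where 'a = complex]) (use per in blast)
  have "\<exists>\<theta>\<ge>0. \<theta> \<le> pi / 2 \<and> ?\<phi> \<theta> = z1"
    by (rule IVT'[OF _ _ _ cont]) (use z1 in \<open>auto simp: fold_angle_def\<close>)
  then obtain a where a: "0 \<le> a" "a \<le> pi / 2" "?\<phi> a = z1" by blast
  have "\<exists>\<theta>\<ge>3 * pi / 2. \<theta> \<le> 2 * pi \<and> ?\<phi> \<theta> = z2"
    by (rule IVT'[OF _ _ _ cont]) (use z2 s32 in \<open>auto simp: fold_angle_def\<close>)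
  then obtain b where b: "3 * pi / 2 \<le> b" "b \<le> 2 * pi" "?\<phi> b = z2" by blast
  have "0 \<le> sin a" using a by (intro sin_ge_zero) auto
  moreover have "sin b \<le> 0" using b by (cases "b = 2 * pi") (auto intro!: sin_le_zero)
  ultimately have "0 \<le> s * sin a" "s * sin b \<le> 0" using s by (simp_all add: mult_nonneg_nonpos)
  then have "pi < (Im (l (?\<phi> a)) + s * sin a) - (Im (l (?\<phi> b)) + s * sin b)"
    using y a(3) b(3) z1 z2 by simp
  then show ?thesis unfolding wide_def by (intro exI[of _ a] exI[of _ b]) simp
qed

text \<open>
The folding map sends \<open>\<pi>/2\<close> and \<open>3\<pi>/2\<close> to \<open>2\<pi>\<close> and \<open>0\<close>, where \<open>l\<close> agrees. Hence the angles there differ by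
the contribution \<open>4\<close> of the sine term, whatever the factor \<open>r\<close>.
\<close>

lemma wide_scaled_fold_angle_add_sin:
  assumes l: "log_loop l"
  shows "wide (\<lambda>\<theta>. of_real r * l (fold_angle (3 * pi / 2) \<theta>) + \<i> * of_real (2 * sin \<theta>))"
proof -
  have s32: "sin (3 * pi / 2) = -1" using sin_3over2_pi by (simp add: mult.commute)
  have "fold_angle (3 * pi / 2) (pi / 2) = 2 * pi" "fold_angle (3 * pi / 2) (3 * pi / 2) = 0"
    by (simp_all add: fold_angle_def s32)
  moreover have "l (2 * pi) = l 0" using l by (auto simp: log_loop_def dest: spec[of _ 0])
  ultimately show ?thesis
    unfolding wide_def using s32 pi_less_4 by (intro exI[of _ "pi / 2"] exI[of _ "3 * pi / 2"]) simp
qed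

text \<open>
Three consecutive stages, each of length \<open>1/3\<close>: fold the angle, add the sine term, and fade out
\<open>l\<close>. The truncations keep each of the three parameters constant outside its own stage.
\<close>

definition deform :: "real \<Rightarrow> (real \<Rightarrow> complex) \<Rightarrow> real \<Rightarrow> complex" where
  "deform t l \<theta> = of_real (min 1 (3 - 3 * t)) * l (fold_angle (min 1 (3 * t) * (3 * pi / 2)) \<theta>)
     + \<i> * of_real (2 * max 0 (min 1 (3 * t - 1)) * sin \<theta>)"

lemma wide_deform:
  assumes l: "log_loop l" "wide l"
  shows "wide (deform t l)"
proof -
  consider "t \<le> 1/3" | "1/3 \<le> t" "t \<le> 2/3" | "2/3 \<le> t" by linarith
  then show ?thesis
  proof cases
    case 1
    then have "deform t l = (\<lambda>\<theta>. l (fold_angle (min 1 (3 * t) * (3 * pi / 2)) \<theta>))"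
      by (auto simp: deform_def fun_eq_iff)
    then show ?thesis using wide_fold_angle[OF l(2)] by simp
  next
    case 2
    then have "deform t l = (\<lambda>\<theta>. l (fold_angle (3 * pi / 2) \<theta>) + \<i> * of_real ((2 * (3 * t - 1)) * sin \<theta>))"
    proof -
      have "min 1 (3 - 3 * t) = 1" "min 1 (3 * t) = 1" "max 0 (min 1 (3 * t - 1)) = 3 * t - 1"
        using 2 by auto
      then show ?thesis by (simp only: deform_def fun_eq_iff of_real_1 mult_1) blast
    qed
    then show ?thesis using wide_fold_angle_add_sin[OF l, of "2 * (3 * t - 1)"] 2 by simp
  next
    case 3
    then have "deform t l = (\<lambda>\<theta>. of_real (min 1 (3 - 3 * t)) * l (fold_angle (3 * pi / 2) \<theta>) + \<i> * of_real (2 * sin \<theta>))"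
      by (auto simp: deform_def fun_eq_iff)
    then show ?thesis using wide_scaled_fold_angle_add_sin[OF l(1)] by simp
  qed
qed

lemma Ck_family_deform:
  assumes l: "Ck_family k X l" and t: "continuous_map X euclideanreal t"
  shows "Ck_family k X (\<lambda>x. deform (t x) (l x))"
proof -
  have cr: "continuous_map X euclidean (\<lambda>x. complex_of_real (f (t x)))" if "continuous_on UNIV f" for f
  proof -
    have "continuous_map euclideanreal euclidean (\<lambda>r. complex_of_real (f r))"
      using that by (simp add: continuous_on_of_real)
    from continuous_map_compose[OF t this] show ?thesis by (simp add: o_def)
  qed
  have sin: "Ck_family k X (\<lambda>x \<theta>. of_real (sin \<theta>))" using Ck_family_sin_cos by blast
  have c: "continuous_map X euclidean (\<lambda>x. complex_of_real (min 1 (3 - 3 * t x)))"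
    "continuous_map X euclidean (\<lambda>x. complex_of_real (min 1 (3 * t x) * (3 * pi / 2)))"
    "continuous_map X euclidean (\<lambda>x. complex_of_real (2 * max 0 (min 1 (3 * t x - 1))))"
    by (rule cr, intro continuous_intros)+
  have "Ck_family k X (\<lambda>x \<theta>. of_real (min 1 (3 * t x) * (3 * pi / 2)) * of_real (sin \<theta>))"
    by (rule Ck_family_mult[OF Ck_family_constant[OF c(2)] sin])
  from Ck_family_compose[OF l this]
  have 1: "Ck_family k X (\<lambda>x \<theta>. of_real (min 1 (3 - 3 * t x)) *
      l x (\<theta> + Re (of_real (min 1 (3 * t x) * (3 * pi / 2)) * of_real (sin \<theta>))))"
    by (rule Ck_family_mult[OF Ck_family_constant[OF c(1)]])
  have "Ck_family k X (\<lambda>x \<theta>. \<i> * (of_real (2 * max 0 (min 1 (3 * t x - 1))) * of_real (sin \<theta>)))"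
    by (intro Ck_family_bounded_linear[OF bounded_linear_mult_right] Ck_family_mult[OF Ck_family_constant[OF c(3)] sin])
  from Ck_family_add[OF 1 this]
  have "Ck_family k X (\<lambda>x \<theta>. of_real (min 1 (3 - 3 * t x)) *
      l x (\<theta> + Re (of_real (min 1 (3 * t x) * (3 * pi / 2)) * of_real (sin \<theta>)))
      + \<i> * (of_real (2 * max 0 (min 1 (3 * t x - 1))) * of_real (sin \<theta>)))" .
  then show ?thesis
    by (rule Ck_family_cong) (simp add: deform_def fold_angle_def)
qed

text \<open>
The tangent angle \<open>2 sin \<theta>\<close>, oscillating between \<open>-2\<close> and \<open>2\<close>, belongs to a figure eight.
\<close>

definition figure_eight_log :: "real \<Rightarrow> complex" where
  "figure_eight_log \<theta> = \<i> * of_real (2 * sin \<theta>)"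

lemma deform_1: "deform 1 l = figure_eight_log"
  by (auto simp: deform_def figure_eight_log_def)

lemma deform_0: "deform 0 l = l"
  by (auto simp: deform_def fold_angle_def)

lemma figure_eight_log_loop_wide: "log_loop figure_eight_log" "wide figure_eight_log"
proof -
  show "log_loop figure_eight_log"
    unfolding log_loop_def figure_eight_log_def[abs_def] by (auto intro!: continuous_intros)
  show "wide figure_eight_log"
    using wide_scaled_fold_angle_add_sin[OF \<open>log_loop figure_eight_log\<close>, of 0] by (simp add: figure_eight_log_def[abs_def])
qed

section \<open>The homotopy equivalence\<close>

theorem proposition3p1:
  "Imm 0 homotopy_equivalent_space top_of_set (sphere (0::complex) 1)"
proof -
  let ?S = "top_of_set (sphere (0::complex) 1)"
  define f where "f c = sgn (theta_deriv c 0)" for c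
  define g where "g z = closed_curve 0 z figure_eight_log" for z
  have d0: "continuous_map (Imm 0) euclidean (\<lambda>c. theta_deriv c 0)"
    using loop_family_eval[OF Ck_family_loop_family[OF Ck_family_theta_deriv[OF Ck_family_Imm[of "Suc 0" 0]]]] .
  have e0: "continuous_map (Imm 0) euclidean (\<lambda>c. c 0)"
    using loop_family_eval[OF Ck_family_loop_family[OF Ck_family_Imm[of 0 0]]] .
  have nz: "theta_deriv c 0 \<noteq> 0" if "c \<in> topspace (Imm 0)" for c
    using that by (auto simp: topspace_Imm immersions_def)
  have f: "continuous_map (Imm 0) euclidean f"
    using d0 nz by (auto simp: continuous_map_euclidean_atin f_def[abs_def] intro!: tendsto_sgn)
  then have fS: "continuous_map (Imm 0) ?S f"
    using nz by (auto simp: continuous_map_in_subtopology f_def norm_sgn)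
  have g: "continuous_map ?S (Imm 0) g"
  proof -
    have fam: "Ck_family k ?S (\<lambda>_. figure_eight_log)" for k
    proof -
      have "Ck_family k ?S (\<lambda>_ \<theta>. (\<i> * 2) * of_real (sin \<theta>))"
        using Ck_family_sin_cos by (intro Ck_family_mult Ck_family_constant) auto
      then show ?thesis by (rule Ck_family_cong) (simp add: figure_eight_log_def)
    qed
    have "z \<noteq> 0" if "z \<in> topspace ?S" for z using that by auto
    moreover have "continuous_map ?S euclidean (\<lambda>z. z)" by simp
    ultimately show ?thesis
      unfolding g_def[abs_def] using fam figure_eight_log_loop_wide(2) by (intro continuous_map_closed_curve) simp_all
  qed
  have fg: "f (g z) = z" if "z \<in> sphere 0 1" for z
  proof -
    have "f (g z) = sgn (z * of_real (exp (Re (closing_vector figure_eight_log))))"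
      by (simp add: f_def g_def theta_deriv_closed_curve[OF figure_eight_log_loop_wide(1)] tilt_def figure_eight_log_def inner_complex_def exp_of_real)
    also have "\<dots> = sgn z" by (simp add: sgn_mult sgn_of_real)
    also have "\<dots> = z" using that by (simp add: sgn_div_norm)
    finally show ?thesis .
  qed
  have "homotopic_with (\<lambda>_. True) ?S ?S (f \<circ> g) id"
    by (rule homotopic_with_equal) (use fg continuous_map_compose[OF g fS] in auto)
  moreover have "homotopic_with (\<lambda>_. True) (Imm 0) (Imm 0) id (g \<circ> f)"
  proof (subst homotopic_with, simp, intro exI conjI ballI)
    \<comment> \<open>While the logarithm is contracted, the starting point moves to the origin and the initial
      speed is normalized. The factor in \<open>?u\<close> is a convex combination of positive numbers.\<close>
    let ?X = "prod_topology (top_of_set {0..1}) (Imm 0)"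
    let ?p = "\<lambda>x :: real \<times> (real \<Rightarrow> complex). of_real (1 - fst x) * snd x 0"
    let ?u = "\<lambda>x :: real \<times> (real \<Rightarrow> complex).
      of_real ((1 - fst x) * norm (theta_deriv (snd x) 0) + fst x) * f (snd x)"
    let ?h = "\<lambda>x. closed_curve (?p x) (?u x) (deform (fst x) (log_tangent (snd x)))"
    have t: "continuous_map ?X euclideanreal fst"
      using continuous_map_fst continuous_map_in_subtopology by blast
    have snd: "continuous_map ?X euclidean (\<lambda>x. k (snd x))" if "continuous_map (Imm 0) euclidean k"
      for k :: "(real \<Rightarrow> complex) \<Rightarrow> complex"
      using continuous_map_compose[OF continuous_map_snd that] by (simp add: o_def)
    note cont = t snd[OF d0] snd[OF e0] snd[OF f]
    show "continuous_map ?X (Imm 0) ?h"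
    proof (rule continuous_map_closed_curve)
      show "Ck_family k ?X (\<lambda>x. deform (fst x) (log_tangent (snd x)))" for k
        by (intro Ck_family_deform Ck_family_pullback[OF continuous_map_snd] Ck_family_log_tangent t)
      show "wide (deform (fst x) (log_tangent (snd x)))" if "x \<in> topspace ?X" for x
        using that by (intro wide_deform Imm_log_tangent) auto
      show "continuous_map ?X euclidean ?p" "continuous_map ?X euclidean ?u"
        using cont by (auto simp: continuous_map_euclidean_atin intro!: tendsto_intros)
      show "?u x \<noteq> 0" if "x \<in> topspace ?X" for x
      proof -
        have x: "0 \<le> fst x" "fst x \<le> 1" "theta_deriv (snd x) 0 \<noteq> 0" using that nz by auto
        have "(1 - fst x) * norm (theta_deriv (snd x) 0) + fst x > 0"
          using x by (cases "fst x = 0") (auto intro!: add_nonneg_pos)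
        moreover have "f (snd x) \<noteq> 0" using x(3) by (simp add: f_def sgn_zero_iff)
        ultimately show ?thesis by (metis mult_eq_0_iff of_real_eq_0_iff less_irrefl)
      qed
    qed
    fix c assume c: "c \<in> topspace (Imm 0)"
    have "of_real (norm (theta_deriv c 0)) * sgn (theta_deriv c 0) = theta_deriv c 0"
      using nz[OF c] by (simp add: sgn_eq)
    then show "?h (0, c) = id c"
      using Imm_log_tangent(3)[OF c] by (simp add: deform_0 f_def)
    show "?h (1, c) = (g \<circ> f) c" by (simp add: deform_1 g_def)
  qed auto
  then have "homotopic_with (\<lambda>_. True) (Imm 0) (Imm 0) (g \<circ> f) id"
    by (simp add: homotopic_with_sym)
  ultimately show ?thesis
    unfolding homotopy_equivalent_space_def using fS g by blast
qed

end
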